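(* Let $\sigma>0$ and let $f$ be a solution of the Riccati equation $\sigma f'+\frac12f^2=\frac{C}{x^2}+\frac B2+\frac18(A-16\mu\sigma)x^2$ with $A>0$. Then the PDE $$u_t=\sigma u_{xx}+f(x)u_x-\mu x^2u,\qquad x>0,$$ has a fundamental solution of the form $$p(t,x,y)=\frac{\sqrt{Axy}}{2\sinh(\sqrt At/2)}\exp\left(-\frac{Bt}{4\sigma}+\frac{F(y)-F(x)}{2\sigma}-\frac{\sqrt A(x^2+y^2)}{8\sigma\tanh(\sqrt At/2)}\right)\left(C_1(y)I_\beta\left(\frac{\sqrt A\,xy}{4\sigma\sinh(\sqrt At/2)}\right)+C_2(y)I_{-\beta}\left(\frac{\sqrt A\,xy}{4\sigma\sinh(\sqrt At/2)}\right)\right)$$ for some functions $C_1(y),C_2(y)$. Here $F'=f$, $\beta=\frac12\sqrt{1+2C/\sigma^2}$ and $I_{-\beta}$ is interpreted as $K_\beta$ if $\beta$ is an integer.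
   Context: $I_\beta,K_\beta$ are the modified Bessel functions of the first and second kind. A fundamental solution of the PDE is a kernel $p(t,x,y)$, $t>0$, $x,y>0$, such that for suitable initial data $\varphi$ (e.g. continuous with compact support in $(0,\infty)$) the function $u(x,t)=\int_0^\infty\varphi(y)p(t,x,y)\,dy$ solves the PDE for $t>0$ and satisfies $u(x,0)=\varphi(x)$. Fundamental solutions need not be unique. *)

theory Defs
  imports "HOL-Analysis.Analysis"
begin

(* Modified Bessel functions of real order nu at a real argument z > 0.
   The power series uses 1/Gamma, so terms at the poles of Gamma vanish. *)

definition bessel_I :: "real \<Rightarrow> real \<Rightarrow> real" where
  "bessel_I \<nu> z = (z / 2) powr \<nu> * (\<Sum>k. (z\<^sup>2 / 4) ^ k / fact k * rGamma (\<nu> + real k + 1))"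

(* For integer order the defining quotient is 0/0, and K is its limit in the order. *)
definition bessel_K :: "real \<Rightarrow> real \<Rightarrow> real" where
  "bessel_K \<nu> z =
     (let q = (\<lambda>\<alpha>. pi / 2 * (bessel_I (- \<alpha>) z - bessel_I \<alpha> z) / sin (\<alpha> * pi))
      in if \<nu> \<in> \<int> then Lim (at \<nu>) q else q \<nu>)"

definition bessel_I_neg :: "real \<Rightarrow> real \<Rightarrow> real" where
  "bessel_I_neg \<beta> z = (if \<beta> \<in> \<int> then bessel_K \<beta> z else bessel_I (- \<beta>) z)"

(* Classical (C^{1,2}) solution of u_t = sigma u_xx + f(x) u_x - mu x^2 u
   on t > 0, x > 0, with u written as a function of t and then x. *)
definition solves_pde :: "real \<Rightarrow> (real \<Rightarrow> real) \<Rightarrow> real \<Rightarrow> (real \<Rightarrow> real \<Rightarrow> real) \<Rightarrow> bool" where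
  "solves_pde \<sigma> f \<mu> u \<longleftrightarrow>
     (\<exists>ut ux uxx.
        continuous_on ({0<..} \<times> {0<..}) (\<lambda>(t, x). ut t x) \<and>
        continuous_on ({0<..} \<times> {0<..}) (\<lambda>(t, x). ux t x) \<and>
        continuous_on ({0<..} \<times> {0<..}) (\<lambda>(t, x). uxx t x) \<and>
        (\<forall>t>0. \<forall>x>0.
           ((\<lambda>s. u s x) has_real_derivative ut t x) (at t) \<and>
           ((\<lambda>z. u t z) has_real_derivative ux t x) (at x) \<and>
           ((\<lambda>z. ux t z) has_real_derivative uxx t x) (at x) \<and>
           ut t x = \<sigma> * uxx t x + f x * ux t x - \<mu> * x\<^sup>2 * u t x))"

definition test_data :: "(real \<Rightarrow> real) \<Rightarrow> bool" where
  "test_data \<phi> \<longleftrightarrow> continuous_on {0<..} \<phi> \<and>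
     (\<exists>K. compact K \<and> K \<subseteq> {0<..} \<and> (\<forall>y>0. y \<notin> K \<longrightarrow> \<phi> y = 0))"

(* The condition u(x,0) = phi(x) means that u extends continuously to t = 0, x > 0 by phi.
   Integrability is required explicitly because a non-integrable function has integral 0. *)
definition fundamental_solution ::
  "real \<Rightarrow> (real \<Rightarrow> real) \<Rightarrow> real \<Rightarrow> (real \<Rightarrow> real \<Rightarrow> real \<Rightarrow> real) \<Rightarrow> bool" where
  "fundamental_solution \<sigma> f \<mu> p \<longleftrightarrow>
     (\<forall>\<phi>. test_data \<phi> \<longrightarrow>
        (let u = (\<lambda>t x. LINT y:{0<..}|lborel. \<phi> y * p t x y) in
          (\<forall>t>0. \<forall>x>0. set_integrable lborel {0<..} (\<lambda>y. \<phi> y * p t x y)) \<and>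
          solves_pde \<sigma> f \<mu> u \<and>
          (\<forall>x0>0. ((\<lambda>(t, x). u t x) \<longlongrightarrow> \<phi> x0) (at (0, x0) within {0<..} \<times> {0<..}))))"

end

theory Submission
  imports Defs
begin

text \<open>Take \<open>C1 = 1 / (2 * \<sigma>)\<close> and \<open>C2 = 0\<close>. Existence of \<open>f\<close> on all of \<open>(0, \<infinity>)\<close> forces
  \<open>1 + 2 * C / \<sigma>\<^sup>2 \<ge> 0\<close>, since otherwise \<open>f\<close> would blow up at points arbitrarily
  close to \<open>0\<close>; hence \<open>\<beta>\<close> is a genuine nonnegative order. The substitution
  \<open>u = exp (- F / (2 * \<sigma>)) * v\<close> and the Riccati equation turn the equation into
  \<open>v\<^sub>t = \<sigma> * (v\<^sub>x\<^sub>x - (\<beta>\<^sup>2 - 1/4) / x\<^sup>2 * v) - (B / (4 * \<sigma>) + A * x\<^sup>2 / (16 * \<sigma>)) * v\<close>, for which the kernel is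
  verified with Bessel's equation. For the initial condition no asymptotics of \<open>I\<^sub>\<beta>\<close> are needed: up to an
  explicit factor with an explicit limit, the kernel in \<open>y\<close> is a probability density under which
  \<open>a * y\<^sup>2\<close> is a Poisson mixture of Gamma variables. Its first two moments follow from termwise
  integration of the Bessel series, and Chebyshev's inequality gives concentration at \<open>x\<close>.\<close>

section \<open>Modified Bessel functions\<close>

text \<open>For \<nu> \<ge> 0 this is the hypergeometric series 0F1(; \<nu> + 1; w) divided by
  Gamma(\<nu> + 1). Splitting off the real power of z leaves an entire function of w = z^2 /
  4.\<close>

definition bessel_series :: "real \<Rightarrow> real \<Rightarrow> real" where
  "bessel_series \<nu> w = (\<Sum>k. w ^ k / fact k * rGamma (\<nu> + real k + 1))"

lemma bessel_I_eq: "bessel_I \<nu> z = (z / 2) powr \<nu> * bessel_series \<nu> (z\<^sup>2 / 4)"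
  by (simp add: bessel_I_def bessel_series_def)

text \<open>The functional equation divides by \<nu> + k + 1 at each step, which is at least 1.
  Positivity makes the terms of the Bessel series nonnegative later on, and the uniform bound lets
  the exponential series dominate it.\<close>

lemma rGamma_bounds:
  assumes "\<nu> \<ge> 0"
  shows "0 < rGamma (\<nu> + real k + 1) \<and> rGamma (\<nu> + real k + 1) \<le> rGamma (\<nu> + 1)"
proof (induction k)
  case 0
  then show ?case using assms Gamma_real_pos[of "\<nu> + 1"] by (simp add: rGamma_inverse_Gamma)
next
  case (Suc k)
  have "(\<nu> + real k + 1) * rGamma (\<nu> + real (Suc k) + 1) = rGamma (\<nu> + real k + 1)"
    using rGamma_plus1[of "\<nu> + real k + 1"] by (simp add: algebra_simps)
  moreover have "0 < rGamma (\<nu> + real (Suc k) + 1)"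
    using assms Gamma_real_pos[of "\<nu> + real (Suc k) + 1"] by (simp add: rGamma_inverse_Gamma)
  moreover have "1 * rGamma (\<nu> + real (Suc k) + 1) \<le> (\<nu> + real k + 1) * rGamma (\<nu> + real (Suc k) + 1)"
    using assms calculation(2) by (intro mult_right_mono) auto
  ultimately show ?case using Suc by simp
qed

lemma bessel_series_summable:
  assumes "\<nu> \<ge> 0"
  shows "summable (\<lambda>k. w ^ k / fact k * rGamma (\<nu> + real k + 1))"
proof (rule summable_comparison_test')
  show "summable (\<lambda>k. rGamma (\<nu> + 1) * (\<bar>w\<bar> ^ k / fact k))"
    using summable_exp[of "\<bar>w\<bar>"] by (intro summable_mult) (simp add: field_simps)
  show "norm (w ^ k / fact k * rGamma (\<nu> + real k + 1)) \<le> rGamma (\<nu> + 1) * (\<bar>w\<bar> ^ k / fact k)"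
    if "k \<ge> 0" for k
    using mult_left_mono[of "rGamma (\<nu> + real k + 1)" "rGamma (\<nu> + 1)" "\<bar>w\<bar> ^ k / fact k"]
      rGamma_bounds[OF assms, of k]
    by (simp add: abs_mult power_abs mult.commute)
qed

lemma bessel_series_sums:
  assumes "\<nu> \<ge> 0"
  shows "(\<lambda>k. w ^ k / fact k * rGamma (\<nu> + real k + 1)) sums bessel_series \<nu> w"
  unfolding bessel_series_def using bessel_series_summable[OF assms] by (rule summable_sums)

text \<open>Termwise differentiation turns k / k! into 1 / (k - 1)!, and shifting the index back
  raises the argument of \<open>rGamma\<close> by one, which is a shift of the order.\<close>

lemma bessel_series_deriv:
  assumes "\<nu> \<ge> 0"
  shows "(bessel_series \<nu> has_real_derivative bessel_series (\<nu> + 1) w) (at w)"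
proof -
  define c where "c k = rGamma (\<nu> + real k + 1) / fact k" for k
  have s: "summable (\<lambda>k. c k * w ^ k)" for w
    using bessel_series_summable[OF assms, of w] by (simp add: c_def mult_ac)
  have "((\<lambda>w. \<Sum>k. c k * w ^ k) has_real_derivative (\<Sum>k. diffs c k * w ^ k)) (at w)"
    \<comment> \<open>\<open>termdiffs_strong\<close> asks for convergence at a point of larger
      modulus than w.\<close>
    by (rule termdiffs_strong[OF s[of "\<bar>w\<bar> + 1"]]) simp
  moreover have "diffs c k = rGamma (\<nu> + 1 + real k + 1) / fact k" for k
    by (simp add: diffs_def c_def add_ac)
  moreover have "bessel_series \<nu> = (\<lambda>w. \<Sum>k. c k * w ^ k)"
    by (simp add: bessel_series_def c_def mult_ac fun_eq_iff)
  ultimately show ?thesis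
    by (simp add: bessel_series_def[of "\<nu> + 1"] mult_ac)
qed

text \<open>The factor in \<open>rGamma (\<nu> + k + 1) = (\<nu> + k + 1) * rGamma (\<nu> + k +
  2)\<close> is split into \<nu> + 1 and k. The first part gives order \<nu> + 1; the second, whose
  term at k = 0 vanishes, gives order \<nu> + 2 after an index shift.\<close>

lemma bessel_series_recurrence:
  assumes "\<nu> \<ge> 0"
  shows "bessel_series \<nu> w = (\<nu> + 1) * bessel_series (\<nu> + 1) w + w * bessel_series (\<nu> + 2) w"
proof -
  have "(\<lambda>k. w * (w ^ k / fact k * rGamma (\<nu> + 2 + real k + 1))) sums (w * bessel_series (\<nu> + 2) w)"
    using assms by (intro sums_mult bessel_series_sums) auto
  also have "(\<lambda>k. w * (w ^ k / fact k * rGamma (\<nu> + 2 + real k + 1)))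
      = (\<lambda>k. real (Suc k) * (w ^ Suc k / fact (Suc k) * rGamma (\<nu> + 1 + real (Suc k) + 1)))"
    by (auto simp: fun_eq_iff add_ac divide_simps)
  finally have a: "(\<lambda>k. real k * (w ^ k / fact k * rGamma (\<nu> + 1 + real k + 1))) sums (w * bessel_series (\<nu> + 2) w)"
    by (subst (asm) sums_Suc_iff) simp
  have b: "(\<lambda>k. (\<nu> + 1) * (w ^ k / fact k * rGamma (\<nu> + 1 + real k + 1))) sums ((\<nu> + 1) * bessel_series (\<nu> + 1) w)"
    using assms by (intro sums_mult bessel_series_sums) auto
  have c: "rGamma (\<nu> + real k + 1) = (\<nu> + real k + 1) * rGamma (\<nu> + 1 + real k + 1)" for k
    using rGamma_plus1[of "\<nu> + real k + 1"] by (simp add: algebra_simps)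
  have "(\<lambda>k. (\<nu> + 1) * (w ^ k / fact k * rGamma (\<nu> + 1 + real k + 1))
           + real k * (w ^ k / fact k * rGamma (\<nu> + 1 + real k + 1)))
      = (\<lambda>k. w ^ k / fact k * rGamma (\<nu> + real k + 1))"
    unfolding c by (auto simp: fun_eq_iff algebra_simps add_divide_distrib)
  with sums_add[OF b a] show ?thesis
    using sums_unique2[OF bessel_series_sums[OF assms]] by simp
qed

lemma bessel_series_nonneg:
  assumes "\<nu> \<ge> 0" "w \<ge> 0"
  shows "bessel_series \<nu> w \<ge> 0"
  unfolding bessel_series_def
proof (rule suminf_nonneg[OF bessel_series_summable[OF assms(1)]])
  fix k
  show "0 \<le> w ^ k / fact k * rGamma (\<nu> + real k + 1)"
    using rGamma_bounds[OF assms(1), of k] assms by simp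
qed

lemma continuous_on_bessel_series:
  assumes "\<nu> \<ge> 0"
  shows "continuous_on X (bessel_series \<nu>)"
  using bessel_series_deriv[OF assms] DERIV_isCont continuous_at_imp_continuous_on by blast

section \<open>Derivatives of the Bessel function and the modified Bessel equation\<close>

lemma bessel_I_deriv:
  assumes "\<nu> \<ge> 0" "z > 0"
  shows "(bessel_I \<nu> has_real_derivative \<nu> / z * bessel_I \<nu> z + bessel_I (\<nu> + 1) z) (at z)"
proof -
  have *: "((\<lambda>z. (z / 2) powr \<nu> * bessel_series \<nu> (z\<^sup>2 / 4)) has_real_derivative
      (\<nu> * (z / 2) powr (\<nu> - 1) * (1 / 2)) * bessel_series \<nu> (z\<^sup>2 / 4)
      + (bessel_series (\<nu> + 1) (z\<^sup>2 / 4) * (z / 2)) * (z / 2) powr \<nu>) (at z)"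
    using assms
    by (auto intro!: derivative_eq_intros DERIV_chain2[OF bessel_series_deriv[OF assms(1)]]
             simp: powr_diff field_simps)
  have **: "(z / 2) powr (\<nu> - 1) = (z / 2) powr \<nu> / (z / 2)" "(z / 2) powr (\<nu> + 1) = (z / 2) powr \<nu> * (z / 2)"
    using assms by (simp_all add: powr_diff powr_add)
  have "(\<nu> * (z / 2) powr (\<nu> - 1) * (1 / 2)) * bessel_series \<nu> (z\<^sup>2 / 4)
      + (bessel_series (\<nu> + 1) (z\<^sup>2 / 4) * (z / 2)) * (z / 2) powr \<nu>
      = \<nu> / z * bessel_I \<nu> z + bessel_I (\<nu> + 1) z"
    using assms by (simp add: bessel_I_eq ** mult_ac)
  with * show ?thesis
    by (simp only: bessel_I_eq[abs_def])
qed

lemma bessel_I_recurrence: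
  assumes "\<nu> \<ge> 0" "z > 0"
  shows "bessel_I \<nu> z = 2 * (\<nu> + 1) / z * bessel_I (\<nu> + 1) z + bessel_I (\<nu> + 2) z"
proof -
  have "(z / 2) powr (\<nu> + 1) = (z / 2) powr \<nu> * (z / 2)"
    "(z / 2) powr (\<nu> + 2) = (z / 2) powr \<nu> * (z\<^sup>2 / 4)"
    using assms by (simp_all add: powr_add power2_eq_square)
  then show ?thesis
    unfolding bessel_I_eq bessel_series_recurrence[OF assms(1), of "z\<^sup>2 / 4"]
    using assms by (simp only:) (simp add: field_simps)
qed

text \<open>Among the standard formulas for the derivative this one only raises the order, so all
  orders that occur stay in the range \<nu> \<ge> 0 of the series lemmas.\<close>

definition bessel_I' :: "real \<Rightarrow> real \<Rightarrow> real" where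
  "bessel_I' \<nu> z = \<nu> / z * bessel_I \<nu> z + bessel_I (\<nu> + 1) z"

text \<open>The modified Bessel equation z^2 I'' + z I' - (z^2 + \<nu>^2) I = 0 solved for I''. That
  it is the derivative of \<open>bessel_I'\<close> is shown next.\<close>

definition bessel_I'' :: "real \<Rightarrow> real \<Rightarrow> real" where
  "bessel_I'' \<nu> z = (1 + \<nu>\<^sup>2 / z\<^sup>2) * bessel_I \<nu> z - bessel_I' \<nu> z / z"

text \<open>A second differentiation brings in the orders \<nu>, \<nu> + 1 and \<nu> + 2. The
  recurrence removes \<nu> + 2, and what remains is Bessel's equation.\<close>

lemma bessel_I'_deriv:
  assumes "\<nu> \<ge> 0" "z > 0"
  shows "(bessel_I' \<nu> has_real_derivative bessel_I'' \<nu> z) (at z)"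
proof -
  have *: "(bessel_I' \<nu> has_real_derivative
      - \<nu> / z\<^sup>2 * bessel_I \<nu> z + \<nu> / z * (\<nu> / z * bessel_I \<nu> z + bessel_I (\<nu> + 1) z)
      + ((\<nu> + 1) / z * bessel_I (\<nu> + 1) z + bessel_I (\<nu> + 1 + 1) z)) (at z)"
    unfolding bessel_I'_def using assms
    by (auto intro!: derivative_eq_intros bessel_I_deriv simp: power2_eq_square field_simps)
  have a: "\<nu> + 1 + 1 = \<nu> + 2" by simp
  have b: "bessel_I (\<nu> + 2) z = bessel_I \<nu> z - 2 * (\<nu> + 1) / z * bessel_I (\<nu> + 1) z"
    using bessel_I_recurrence[OF assms] by simp
  show ?thesis
    by (rule DERIV_cong[OF *])
      (use assms in \<open>simp add: bessel_I''_def bessel_I'_def a b power2_eq_square field_simps\<close>)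
qed

lemma continuous_on_bessel_I:
  assumes "\<nu> \<ge> 0"
  shows "continuous_on {0<..} (bessel_I \<nu>)" "continuous_on {0<..} (bessel_I' \<nu>)"
    "continuous_on {0<..} (bessel_I'' \<nu>)"
proof -
  show 1: "continuous_on {0<..} (bessel_I \<nu>)"
    by (rule DERIV_continuous_on, rule has_field_derivative_at_within, rule bessel_I_deriv[OF assms]) simp
  show 2: "continuous_on {0<..} (bessel_I' \<nu>)"
    by (rule DERIV_continuous_on, rule has_field_derivative_at_within, rule bessel_I'_deriv[OF assms]) simp
  show "continuous_on {0<..} (bessel_I'' \<nu>)"
    unfolding bessel_I''_def by (intro continuous_intros 1 2) auto
qed

section \<open>The Riccati equation near the origin\<close>

text \<open>In the variable \<open>ln x\<close> the function \<open>g = x * f / (2 * \<sigma>) - 1/2\<close> satisfies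
  \<open>g' = - g\<^sup>2 + 1/4 + C / (2 * \<sigma>\<^sup>2) + O(x\<^sup>2)\<close>, so a negative constant makes it blow up near \<open>x = 0\<close>.\<close>

lemma riccati_nonoscillation:
  fixes f :: "real \<Rightarrow> real"
  assumes \<sigma>: "\<sigma> > 0"
    and diff: "\<And>x. x > 0 \<Longrightarrow> f differentiable (at x)"
    and ric: "\<And>x. x > 0 \<Longrightarrow> \<sigma> * deriv f x + 1/2 * (f x)\<^sup>2 = C / x\<^sup>2 + b + d * x\<^sup>2"
  shows "1 + 2 * C / \<sigma>\<^sup>2 \<ge> 0"
proof (rule ccontr)
  assume neg: "\<not> 1 + 2 * C / \<sigma>\<^sup>2 \<ge> 0"
  \<comment> \<open>Chosen so that \<open>2 * e\<^sup>2\<close> is minus the constant in the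
    equation for g: one half absorbs the O(x^2) terms, the other keeps g decreasing in ln x.\<close>
  define e where "e = sqrt (- (1 + 2 * C / \<sigma>\<^sup>2) / 8)"
  have e: "e > 0" "2 * e\<^sup>2 = - (1/4 + C / (2 * \<sigma>\<^sup>2))"
    using neg by (auto simp: e_def)
  have "((\<lambda>x. (b * x\<^sup>2 + d * x ^ 4) / (2 * \<sigma>\<^sup>2)) \<longlongrightarrow> (b * 0\<^sup>2 + d * 0 ^ 4) / (2 * \<sigma>\<^sup>2)) (at_right 0)"
    using \<sigma> by (intro tendsto_intros) auto
  then have "\<forall>\<^sub>F x in at_right 0. (b * x\<^sup>2 + d * x ^ 4) / (2 * \<sigma>\<^sup>2) < e\<^sup>2"
    using e by (intro order_tendstoD(2)) auto
  then obtain x1 where x1: "x1 > 0" "\<And>x. 0 < x \<Longrightarrow> x < x1 \<Longrightarrow> (b * x\<^sup>2 + d * x ^ 4) / (2 * \<sigma>\<^sup>2) < e\<^sup>2"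
    unfolding eventually_at_right_field by auto
  define g where "g x = x * f x / (2 * \<sigma>) - 1/2" for x
  define g' where "g' x = f x / (2 * \<sigma>) + x * deriv f x / (2 * \<sigma>)" for x
  \<comment> \<open>Near 0 one has \<open>x * g' x \<le> - (e\<^sup>2 + (g x)\<^sup>2)\<close>, so
    in the variable ln x the arctan falls at rate at least e and \<theta> is nonincreasing. Yet its
    first term is bounded and its second tends to minus infinity at 0.\<close>
  define \<theta> where "\<theta> x = arctan (g x / e) + e * ln x" for x
  have df: "(f has_real_derivative deriv f x) (at x)" if "x > 0" for x
    using diff[OF that] by (simp add: DERIV_deriv_iff_real_differentiable)
  have dg: "(g has_real_derivative g' x) (at x)" if "x > 0" for x
    unfolding g_def g'_def using \<sigma> that
    by (auto intro!: derivative_eq_intros df simp: field_simps)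
  have eq: "x * g' x = - (g x)\<^sup>2 - 2 * e\<^sup>2 + (b * x\<^sup>2 + d * x ^ 4) / (2 * \<sigma>\<^sup>2)" if "x > 0" for x
  proof -
    have "deriv f x = (C / x\<^sup>2 + b + d * x\<^sup>2 - 1/2 * (f x)\<^sup>2) / \<sigma>"
      using ric[OF that] \<sigma> by (simp add: field_simps)
    then show ?thesis
      unfolding e g_def g'_def using \<sigma> that
      by (simp only:) (simp add: field_simps power2_eq_square power4_eq_xxxx)
  qed
  have d\<theta>: "(\<theta> has_real_derivative e * g' x / (e\<^sup>2 + (g x)\<^sup>2) + e / x) (at x)" if "x > 0" for x
  proof -
    have "(\<theta> has_real_derivative inverse (1 + (g x / e)\<^sup>2) * (g' x / e) + e * (1 / x)) (at x)"
      unfolding \<theta>_def using e that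
      by (auto intro!: derivative_eq_intros DERIV_chain2[OF DERIV_arctan] dg)
    moreover have "inverse (1 + (g x / e)\<^sup>2) * (g' x / e) = e * g' x / (e\<^sup>2 + (g x)\<^sup>2)"
    proof -
      have "e\<^sup>2 + (g x)\<^sup>2 > 0" using e by (simp add: add_pos_nonneg)
      then show ?thesis using e by (simp add: divide_simps) (simp add: power2_eq_square algebra_simps)
    qed
    ultimately show ?thesis by simp
  qed
  have neg': "e * g' x / (e\<^sup>2 + (g x)\<^sup>2) + e / x \<le> 0" if "0 < x" "x < x1" for x
  proof -
    have p: "e\<^sup>2 + (g x)\<^sup>2 > 0" using e by (simp add: add_pos_nonneg)
    have "x * g' x \<le> - (e\<^sup>2 + (g x)\<^sup>2)"
      using eq[of x] x1(2)[of x] that by simp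
    then have "e * (x * g' x + (e\<^sup>2 + (g x)\<^sup>2)) \<le> 0"
      using e by (simp add: mult_le_0_iff)
    moreover have "e * g' x / D + e / x = e * (x * g' x + D) / (x * D)" if "D > 0" for D
      using \<open>0 < x\<close> that by (simp add: field_simps)
    ultimately show ?thesis using p that by (simp add: divide_le_0_iff)
  qed
  define x2 where "x2 = x1 / 2"
  have x2: "0 < x2" "x2 < x1" using x1 by (auto simp: x2_def)
  have mono: "\<theta> x2 \<le> \<theta> x" if "0 < x" "x \<le> x2" for x
  proof (rule DERIV_nonpos_imp_nonincreasing[OF that(2)])
    fix z assume "x \<le> z" "z \<le> x2"
    then have "0 < z" "z < x1" using that x2 by auto
    then show "\<exists>y. (\<theta> has_real_derivative y) (at z) \<and> y \<le> 0"
      using d\<theta> neg' by blast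
  qed
  \<comment> \<open>Small enough that \<open>e * ln x \<le> \<theta> x2 - pi\<close>. The arctan
    wins back less than pi / 2, so \<open>\<theta> x < \<theta> x2\<close>, against
    monotonicity.\<close>
  define x where "x = min x2 (exp ((\<theta> x2 - pi) / e))"
  have x: "0 < x" "x \<le> x2" using x2 by (auto simp: x_def)
  have "ln x \<le> ln (exp ((\<theta> x2 - pi) / e))"
    using x by (subst ln_le_cancel_iff) (auto simp: x_def)
  then have "e * ln x \<le> \<theta> x2 - pi"
    using e by (simp add: field_simps)
  moreover have "\<theta> x < pi / 2 + e * ln x"
    using arctan_ubound[of "g x / e"] by (simp add: \<theta>_def)
  ultimately show False using mono[OF x] pi_gt_zero by linarith
qed

section \<open>Concentration of the Bessel weight\<close>

text \<open>Euler's integral for Gamma under the substitution t = a y^2.\<close>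

lemma has_bochner_integral_gaussian_moment:
  assumes "\<alpha> > 0" "a > 0"
  shows "has_bochner_integral lborel
    (\<lambda>y::real. indicator {0<..} y * (y powr (2 * \<alpha> - 1) * exp (- (a * y\<^sup>2)))) (Gamma \<alpha> / (2 * a powr \<alpha>))"
proof -
  let ?f = "\<lambda>t::real. t powr (\<alpha> - 1) / exp t"
  let ?k = "\<lambda>y::real. y powr (2 * \<alpha> - 1) * exp (- (a * y\<^sup>2))"
  have im: "(\<lambda>y::real. a * y\<^sup>2) ` {0<..} = {0<..}"
  proof (intro equalityI subsetI)
    fix t :: real assume "t \<in> {0<..}"
    then have "t = a * (sqrt (t / a))\<^sup>2" "sqrt (t / a) \<in> {0<..}" using assms by auto
    then show "t \<in> (\<lambda>y. a * y\<^sup>2) ` {0<..}" by blast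
  qed (use assms in auto)
  \<comment> \<open>The point 0 is dropped: Euler's integral is stated on the closed half-line,
    while the substitution maps the open one onto itself.\<close>
  have "(?f has_integral Gamma \<alpha>) {0<..}"
    by (rule has_integral_spike_set_eq[THEN iffD1, OF _ _ Gamma_integral_real[OF assms(1)]];
        rule negligible_subset[of "{0}"]) auto
  then have "?f absolutely_integrable_on {0<..} \<and> integral {0<..} ?f = Gamma \<alpha>"
    by (intro conjI nonnegative_absolutely_integrable_1) auto
  then have "(\<lambda>y. \<bar>2 * a * y\<bar> *\<^sub>R ?f (a * y\<^sup>2)) absolutely_integrable_on {0<..} \<and>
      integral {0<..} (\<lambda>y. \<bar>2 * a * y\<bar> *\<^sub>R ?f (a * y\<^sup>2)) = Gamma \<alpha>"
    using assms
    by (subst has_absolute_integral_change_of_variables_real[where g = "\<lambda>y. a * y\<^sup>2"])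
       (auto simp: im inj_on_def power2_eq_iff_nonneg intro!: derivative_eq_intros)
  then have "((\<lambda>y. \<bar>2 * a * y\<bar> *\<^sub>R ?f (a * y\<^sup>2)) has_integral Gamma \<alpha>) {0<..}"
    using set_lebesgue_integral_eq_integral(1) by (auto simp: has_integral_iff)
  moreover have "\<bar>2 * a * y\<bar> *\<^sub>R ?f (a * y\<^sup>2) = 2 * a powr \<alpha> * ?k y" if "y \<in> {0<..}" for y
  proof -
    have "(a * y\<^sup>2) powr (\<alpha> - 1) = a powr \<alpha> / a * (y powr (2 * \<alpha> - 1) / y)"
    proof -
      have "y powr (\<alpha> - 1) * y powr (\<alpha> - 1) = y powr ((2 * \<alpha> - 1) - 1)"
        by (simp flip: powr_add)
      then have "y powr (\<alpha> - 1) * y powr (\<alpha> - 1) = y powr (2 * \<alpha> - 1) / y"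
        using that by (simp only: powr_diff) simp
      then show ?thesis
        using that assms by (simp add: power2_eq_square powr_mult powr_diff[of a])
    qed
    then show ?thesis using that assms by (simp add: exp_minus field_simps)
  qed
  ultimately have "((\<lambda>y. 2 * a powr \<alpha> * ?k y) has_integral Gamma \<alpha>) {0<..}"
    by (rule has_integral_eq[rotated])
  from has_integral_mult_right[OF this, of "1 / (2 * a powr \<alpha>)"]
  have "(?k has_integral Gamma \<alpha> / (2 * a powr \<alpha>)) {0<..}"
    using assms by simp
  \<comment> \<open>The integrand is nonnegative, so the gauge integral fixes the Lebesgue integral
    and gives integrability with it.\<close>
  from nn_integral_has_integral_lebesgue[OF _ this]
  have "nn_integral lborel (\<lambda>y. ennreal (indicator {0<..} y * ?k y)) = Gamma \<alpha> / (2 * a powr \<alpha>)"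
    by simp
  then show ?thesis
    using assms by (intro has_bochner_integral_nn_integral) auto
qed

text \<open>For l > 0 and y > 0 this is a constant multiple of \<open>y powr (\<nu> + 1) * exp (- (a
  * y\<^sup>2)) * bessel_I \<nu> (2 * sqrt l * y)\<close>, up to normalisation the density of a
  scaled noncentral chi variable with 2 \<nu> + 2 degrees of freedom. The series form shows the
  Gamma mixture and covers l = 0.\<close>

definition bessel_weight :: "real \<Rightarrow> real \<Rightarrow> real \<Rightarrow> real \<Rightarrow> real" where
  "bessel_weight \<nu> a l y =
     indicator {0<..} y * (y powr (2 * \<nu> + 1) * exp (- (a * y\<^sup>2)) * bessel_series \<nu> (l * y\<^sup>2))"

lemma bessel_weight_nonneg: "\<nu> \<ge> 0 \<Longrightarrow> l \<ge> 0 \<Longrightarrow> bessel_weight \<nu> a l y \<ge> 0"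
  by (simp add: bessel_weight_def bessel_series_nonneg)

text \<open>The terms of the Bessel series are integrated one by one. The Gamma value from the k-th
  integral meets \<open>rGamma (\<nu> + k + 1)\<close>, and their product is a Pochhammer symbol, so
  the moment is a sum against unnormalised Poisson weights with parameter l / a.\<close>

lemma bessel_weight_moment:
  assumes "\<nu> \<ge> 0" "a > 0" "l \<ge> 0"
    and P: "(\<lambda>k. (l / a) ^ k / fact k * pochhammer (\<nu> + real k + 1) j) sums P"
  shows "has_bochner_integral lborel (\<lambda>y. (y\<^sup>2) ^ j * bessel_weight \<nu> a l y) (P / (2 * a powr (\<nu> + 1 + real j)))"
proof -
  define c where "c k = l ^ k / fact k * rGamma (\<nu> + real k + 1)" for k
  define f where "f k y = c k * (indicator {0<..} y * (y powr (2 * (\<nu> + real k + 1 + real j) - 1) * exp (- (a * y\<^sup>2))))"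
    for k and y :: real
  have c0: "c k \<ge> 0" for k
    using assms rGamma_bounds[OF assms(1), of k] by (simp add: c_def)
  have f0: "f k y \<ge> 0" for k y
    using c0 by (simp add: f_def)
  have hf: "has_bochner_integral lborel (f k)
      (1 / (2 * a powr (\<nu> + 1 + real j)) * ((l / a) ^ k / fact k * pochhammer (\<nu> + real k + 1) j))" for k
  proof -
    let ?z = "\<nu> + real k + 1"
    have "Gamma (?z + real j) > 0" using assms by (intro Gamma_real_pos) simp
    moreover have "rGamma ?z = pochhammer ?z j * rGamma (?z + real j)"
      by (rule pochhammer_rGamma)
    ultimately have "rGamma ?z * Gamma (?z + real j) = pochhammer ?z j"
      by (simp add: rGamma_inverse_Gamma)
    moreover have "a powr (?z + real j) = a powr (\<nu> + 1 + real j) * a ^ k"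
      using assms by (simp add: powr_add powr_realpow)
    ultimately have "c k * (Gamma (?z + real j) / (2 * a powr (?z + real j)))
        = 1 / (2 * a powr (\<nu> + 1 + real j)) * ((l / a) ^ k / fact k * pochhammer ?z j)"
      by (simp add: c_def power_divide mult.assoc)
    moreover have "has_bochner_integral lborel (f k) (c k * (Gamma (?z + real j) / (2 * a powr (?z + real j))))"
      unfolding f_def using assms
      by (intro has_bochner_integral_mult_right has_bochner_integral_gaussian_moment) auto
    ultimately show ?thesis by simp
  qed
  have sums_f: "(\<lambda>k. f k y) sums ((y\<^sup>2) ^ j * bessel_weight \<nu> a l y)" for y
  proof (cases "y > 0")
    case True
    have "y powr (2 * (\<nu> + real k + 1 + real j) - 1) = y powr (2 * \<nu> + 1) * (y\<^sup>2) ^ k * (y\<^sup>2) ^ j" for k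
    proof -
      have "2 * (\<nu> + real k + 1 + real j) - 1 = (2 * \<nu> + 1) + real (2 * k) + real (2 * j)" by simp
      then show ?thesis using True by (simp only: powr_add powr_realpow power_mult)
    qed
    then have "f k y = ((y\<^sup>2) ^ j * (y powr (2 * \<nu> + 1) * exp (- (a * y\<^sup>2)))) *
        ((l * y\<^sup>2) ^ k / fact k * rGamma (\<nu> + real k + 1))" for k
      using True by (simp add: f_def c_def power_mult_distrib mult_ac)
    with sums_mult[OF bessel_series_sums[OF assms(1), of "l * y\<^sup>2"], of "(y\<^sup>2) ^ j * (y powr (2 * \<nu> + 1) * exp (- (a * y\<^sup>2)))"]
    show ?thesis using True by (simp add: bessel_weight_def mult_ac)
  qed (simp add: f_def bessel_weight_def)
  have sums_P: "(\<lambda>k. integral\<^sup>L lborel (f k)) sums (1 / (2 * a powr (\<nu> + 1 + real j)) * P)"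
    unfolding has_bochner_integral_integral_eq[OF hf] by (intro sums_mult P)
  have norm_f: "norm (f k y) = f k y" for k y
    using f0 by simp
  have eq: "(\<lambda>y. \<Sum>k. f k y) = (\<lambda>y. (y\<^sup>2) ^ j * bessel_weight \<nu> a l y)"
    using sums_f by (auto simp: sums_iff)
  have int: "integrable lborel (f k)" for k using hf by (simp add: has_bochner_integral_iff)
  \<comment> \<open>All terms are nonnegative, so the conditions for exchanging sum and integral are
    just the pointwise and integrated sums already found.\<close>
  have s1: "AE y in lborel. summable (\<lambda>k. norm (f k y))"
    unfolding norm_f using sums_f by (auto simp: sums_iff)
  have s2: "summable (\<lambda>k. \<integral>y. norm (f k y) \<partial>lborel)"
    unfolding norm_f using sums_P by (simp add: sums_iff)
  have "integrable lborel (\<lambda>y. (y\<^sup>2) ^ j * bessel_weight \<nu> a l y)"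
    using integrable_suminf[OF int s1 s2] by (simp add: eq)
  moreover have "(\<integral>y. (y\<^sup>2) ^ j * bessel_weight \<nu> a l y \<partial>lborel) = P / (2 * a powr (\<nu> + 1 + real j))"
    using sums_unique2[OF sums_integral[OF int s1 s2] sums_P] by (simp add: eq)
  ultimately show ?thesis
    by (simp add: has_bochner_integral_iff)
qed

text \<open>Unnormalised factorial moments of a Poisson variable. Each follows from the previous one
  by multiplication by s and an index shift; the new term at k = 0 is zero.\<close>

lemma exp_moment_sums:
  fixes s :: real
  shows "(\<lambda>k. s ^ k / fact k) sums exp s"
    and "(\<lambda>k. real k * (s ^ k / fact k)) sums (s * exp s)"
    and "(\<lambda>k. real k * (real k - 1) * (s ^ k / fact k)) sums (s\<^sup>2 * exp s)"
proof -
  show 0: "(\<lambda>k. s ^ k / fact k) sums exp s"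
    using exp_converges[of s] by (simp add: field_simps)
  have "(\<lambda>k. s * (s ^ k / fact k)) = (\<lambda>k. real (Suc k) * (s ^ Suc k / fact (Suc k)))"
    by (auto simp: fun_eq_iff divide_simps)
  with sums_mult[OF 0, of s] show 1: "(\<lambda>k. real k * (s ^ k / fact k)) sums (s * exp s)"
    using sums_Suc_iff[of "\<lambda>k. real k * (s ^ k / fact k)" "s * exp s"] by simp
  have "(\<lambda>k. s * (real k * (s ^ k / fact k))) = (\<lambda>k. real (Suc k) * (real (Suc k) - 1) * (s ^ Suc k / fact (Suc k)))"
    by (auto simp: fun_eq_iff divide_simps)
  with sums_mult[OF 1, of s] show "(\<lambda>k. real k * (real k - 1) * (s ^ k / fact k)) sums (s\<^sup>2 * exp s)"
    using sums_Suc_iff[of "\<lambda>k. real k * (real k - 1) * (s ^ k / fact k)" "s\<^sup>2 * exp s"]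
    by (simp add: power2_eq_square mult_ac)
qed

lemma bessel_weight_moments:
  assumes "\<nu> \<ge> 0" "a > 0" "l \<ge> 0"
  defines "s \<equiv> l / a" and "Z \<equiv> exp (l / a) / (2 * a powr (\<nu> + 1))"
  shows "has_bochner_integral lborel (bessel_weight \<nu> a l) Z"
    and "has_bochner_integral lborel (\<lambda>y. y\<^sup>2 * bessel_weight \<nu> a l y) (Z * ((\<nu> + 1 + s) / a))"
    and "has_bochner_integral lborel (\<lambda>y. y ^ 4 * bessel_weight \<nu> a l y)
           (Z * (((\<nu> + 1) * (\<nu> + 2) + (2 * \<nu> + 4) * s + s\<^sup>2) / a\<^sup>2))"
proof -
  note e = exp_moment_sums[of s]
  show "has_bochner_integral lborel (bessel_weight \<nu> a l) Z"
    using bessel_weight_moment[OF assms(1-3), of 0 "exp s"] e(1) by (simp add: s_def Z_def)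
  have "(\<lambda>k. s ^ k / fact k * pochhammer (\<nu> + real k + 1) 1) sums ((\<nu> + 1) * exp s + s * exp s)"
    using sums_add[OF sums_mult[OF e(1), of "\<nu> + 1"] e(2)] by (simp add: algebra_simps add_divide_distrib)
  from bessel_weight_moment[OF assms(1-3) this[unfolded s_def]]
  show "has_bochner_integral lborel (\<lambda>y. y\<^sup>2 * bessel_weight \<nu> a l y) (Z * ((\<nu> + 1 + s) / a))"
    using assms by (simp add: s_def Z_def powr_add power2_eq_square field_simps)
  \<comment> \<open>The Pochhammer symbol is expanded in the falling factorials 1, k and k (k - 1),
    whose Poisson sums are known.\<close>
  have "(\<lambda>k. s ^ k / fact k * pochhammer (\<nu> + real k + 1) 2) =
     (\<lambda>k. (\<nu> + 1) * (\<nu> + 2) * (s ^ k / fact k) + (2 * \<nu> + 4) * (real k * (s ^ k / fact k))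
          + real k * (real k - 1) * (s ^ k / fact k))"
    by (auto simp: fun_eq_iff pochhammer_Suc numeral_2_eq_2 algebra_simps add_divide_distrib)
  then have "(\<lambda>k. s ^ k / fact k * pochhammer (\<nu> + real k + 1) 2) sums
     ((\<nu> + 1) * (\<nu> + 2) * exp s + (2 * \<nu> + 4) * (s * exp s) + s\<^sup>2 * exp s)"
    using sums_add[OF sums_add[OF sums_mult[OF e(1), of "(\<nu> + 1) * (\<nu> + 2)"] sums_mult[OF e(2), of "2 * \<nu> + 4"]] e(3)]
    by simp
  from bessel_weight_moment[OF assms(1-3) this[unfolded s_def]]
  have "has_bochner_integral lborel (\<lambda>y. (y\<^sup>2) ^ 2 * bessel_weight \<nu> a l y)
      (((\<nu> + 1) * (\<nu> + 2) * exp (l / a) + (2 * \<nu> + 4) * (l / a * exp (l / a)) + (l / a)\<^sup>2 * exp (l / a))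
         / (2 * a powr (\<nu> + 1 + real 2)))" .
  moreover have "a powr (\<nu> + 1 + real 2) = a powr (\<nu> + 1) * a\<^sup>2"
    using assms by (simp only: powr_add powr_realpow)
  moreover have "((\<nu> + 1) * (\<nu> + 2) * E + (2 * \<nu> + 4) * (q * E) + q\<^sup>2 * E) / (2 * (W * a\<^sup>2))
     = E / (2 * W) * (((\<nu> + 1) * (\<nu> + 2) + (2 * \<nu> + 4) * q + q\<^sup>2) / a\<^sup>2)" for E W q :: real
    by (simp add: algebra_simps add_divide_distrib)
  ultimately show "has_bochner_integral lborel (\<lambda>y. y ^ 4 * bessel_weight \<nu> a l y)
           (Z * (((\<nu> + 1) * (\<nu> + 2) + (2 * \<nu> + 4) * s + s\<^sup>2) / a\<^sup>2))"
    by (simp only: s_def Z_def power_mult[symmetric]) (simp add: numeral_eq_Suc)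
qed

text \<open>Chebyshev's inequality for the normalised weight, applied to the square of the variable.\<close>

lemma bessel_weight_concentration:
  fixes a l :: "'i \<Rightarrow> real" and \<psi> :: "real \<Rightarrow> real"
  assumes \<nu>: "\<nu> \<ge> 0"
    and a: "filterlim a at_top \<F>"
    and l: "\<forall>\<^sub>F i in \<F>. l i \<ge> 0"
    and q: "((\<lambda>i. l i / (a i)\<^sup>2) \<longlongrightarrow> x0\<^sup>2) \<F>"
    and x0: "x0 > 0"
    and meas [measurable]: "\<psi> \<in> borel_measurable borel"
    and M: "\<And>y. \<bar>\<psi> y\<bar> \<le> M"
    and cont: "isCont \<psi> x0"
  shows "((\<lambda>i. 2 * a i powr (\<nu> + 1) / exp (l i / a i) *
            (\<integral>y. \<psi> y * bessel_weight \<nu> (a i) (l i) y \<partial>lborel)) \<longlongrightarrow> \<psi> x0) \<F>"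
proof (rule tendstoI)
  fix e :: real assume e: "e > 0"
  from cont have "\<forall>\<^sub>F y in at x0. dist (\<psi> y) (\<psi> x0) < e / 2"
    unfolding isCont_def using e by (intro tendstoD) auto
  then obtain \<delta> where \<delta>: "\<delta> > 0" "\<And>y. y \<noteq> x0 \<Longrightarrow> dist y x0 < \<delta> \<Longrightarrow> dist (\<psi> y) (\<psi> x0) < e / 2"
    unfolding eventually_at by auto
  have M0: "M \<ge> 0" using M[of 0] by linarith
  \<comment> \<open>At distance at least \<delta> from x0 the factorisation of y^2 - x0^2 has
    modulus at least \<delta> x0, so K times its square is at least 2 M, which bounds every gap
    between values of \<psi>.\<close>
  define K where "K = 2 * M / (\<delta> * x0)\<^sup>2"
  have K0: "K \<ge> 0" using M0 by (simp add: K_def)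
  have bound: "\<bar>\<psi> y - \<psi> x0\<bar> \<le> e / 2 + K * (y\<^sup>2 - x0\<^sup>2)\<^sup>2" if y: "y > 0" for y
  proof (cases "\<bar>y - x0\<bar> < \<delta>")
    case True
    then have "\<bar>\<psi> y - \<psi> x0\<bar> \<le> e / 2"
      using \<delta>(2)[of y] e by (cases "y = x0") (auto simp: dist_real_def)
    moreover have "K * (y\<^sup>2 - x0\<^sup>2)\<^sup>2 \<ge> 0" using K0 by simp
    ultimately show ?thesis by linarith
  next
    case False
    have "\<delta> * x0 \<le> \<bar>y - x0\<bar> * (y + x0)"
      using False \<delta> x0 y by (intro mult_mono) auto
    also have "\<dots> = \<bar>y\<^sup>2 - x0\<^sup>2\<bar>"
      using x0 y by (simp add: power2_eq_square square_diff_square_factored abs_mult)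
    finally have "(\<delta> * x0)\<^sup>2 \<le> (y\<^sup>2 - x0\<^sup>2)\<^sup>2"
      using \<delta> x0 by (intro abs_le_square_iff[THEN iffD1]) (simp add: abs_mult)
    then have "K * (\<delta> * x0)\<^sup>2 \<le> K * (y\<^sup>2 - x0\<^sup>2)\<^sup>2"
      using K0 by (intro mult_left_mono) auto
    moreover have "K * (\<delta> * x0)\<^sup>2 = 2 * M" using \<delta> x0 by (simp add: K_def)
    moreover have "\<bar>\<psi> y - \<psi> x0\<bar> \<le> 2 * M" using M[of y] M[of x0] by linarith
    ultimately show ?thesis using e by linarith
  qed
  \<comment> \<open>The mean of (y^2 - x0^2)^2 under the normalised weight, expanded into its
    moments.\<close>
  define V where "V i = ((\<nu> + 1) * (\<nu> + 2) + (2 * \<nu> + 4) * (l i / a i) + (l i / a i)\<^sup>2) / (a i)\<^sup>2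
      - 2 * x0\<^sup>2 * ((\<nu> + 1 + l i / a i) / a i) + x0 ^ 4" for i
  have apos: "\<forall>\<^sub>F i in \<F>. a i > 0" using a by (simp add: filterlim_at_top_dense)
  have V: "(V \<longlongrightarrow> 0) \<F>"
  proof -
    have i: "((\<lambda>i. 1 / a i) \<longlongrightarrow> 0) \<F>"
      using tendsto_inverse_0_at_top[OF a] by (simp add: inverse_eq_divide)
    \<comment> \<open>As a function of the index, V depends only on 1 / a and l / a^2. At their
      limits 0 and x0^2 the surviving terms x0^4 - 2 x0^4 + x0^4 cancel.\<close>
    have "((\<lambda>i. (\<nu> + 1) * (\<nu> + 2) * (1 / a i)\<^sup>2 + (2 * \<nu> + 4) * (l i / (a i)\<^sup>2 * (1 / a i)) + (l i / (a i)\<^sup>2)\<^sup>2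
        - 2 * x0\<^sup>2 * ((\<nu> + 1) * (1 / a i) + l i / (a i)\<^sup>2) + x0 ^ 4) \<longlongrightarrow>
      (\<nu> + 1) * (\<nu> + 2) * 0\<^sup>2 + (2 * \<nu> + 4) * (x0\<^sup>2 * 0) + (x0\<^sup>2)\<^sup>2
        - 2 * x0\<^sup>2 * ((\<nu> + 1) * 0 + x0\<^sup>2) + x0 ^ 4) \<F>"
      by (intro tendsto_intros i q)
    also have "(\<nu> + 1) * (\<nu> + 2) * 0\<^sup>2 + (2 * \<nu> + 4) * (x0\<^sup>2 * 0) + (x0\<^sup>2)\<^sup>2
        - 2 * x0\<^sup>2 * ((\<nu> + 1) * 0 + x0\<^sup>2) + x0 ^ 4 = 0"
      by (simp add: power4_eq_xxxx power2_eq_square)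
    finally show ?thesis
      by (rule Lim_transform_eventually)
        (use apos in \<open>auto elim!: eventually_mono simp: V_def field_simps power2_eq_square\<close>)
  qed
  have "((\<lambda>i. K * V i) \<longlongrightarrow> K * 0) \<F>" by (intro tendsto_intros V)
  then have "\<forall>\<^sub>F i in \<F>. K * V i < e / 2" using e by (intro order_tendstoD(2)) auto
  with apos l show "\<forall>\<^sub>F i in \<F>. dist (2 * a i powr (\<nu> + 1) / exp (l i / a i) *
            (\<integral>y. \<psi> y * bessel_weight \<nu> (a i) (l i) y \<partial>lborel)) (\<psi> x0) < e"
  proof eventually_elim
    case (elim i)
    define W where "W = bessel_weight \<nu> (a i) (l i)"
    define Z where "Z = exp (l i / a i) / (2 * a i powr (\<nu> + 1))"
    \<comment> \<open>The reciprocal of the total mass Z, so that c times the weight is a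
      probability density.\<close>
    define c where "c = 2 * a i powr (\<nu> + 1) / exp (l i / a i)"
    have cZ: "c * Z = 1" "c > 0" using elim by (auto simp: c_def Z_def)
    note m = bessel_weight_moments[OF \<nu> elim(1,2), folded W_def Z_def]
    have W0: "W y \<ge> 0" for y using bessel_weight_nonneg[OF \<nu> elim(2)] by (simp add: W_def)
    have [measurable]: "W \<in> borel_measurable borel"
      using m(1)[THEN has_bochner_integral_iff[THEN iffD1], THEN conjunct1] borel_measurable_integrable by auto
    have "has_bochner_integral lborel (\<lambda>y. (e / 2 + K * x0 ^ 4) * W y - 2 * K * x0\<^sup>2 * (y\<^sup>2 * W y) + K * (y ^ 4 * W y))
        ((e / 2 + K * x0 ^ 4) * Z - 2 * K * x0\<^sup>2 * (Z * ((\<nu> + 1 + l i / a i) / a i)) +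
         K * (Z * (((\<nu> + 1) * (\<nu> + 2) + (2 * \<nu> + 4) * (l i / a i) + (l i / a i)\<^sup>2) / (a i)\<^sup>2)))"
      by (intro has_bochner_integral_add has_bochner_integral_diff has_bochner_integral_mult_right m)
    also have "(\<lambda>y. (e / 2 + K * x0 ^ 4) * W y - 2 * K * x0\<^sup>2 * (y\<^sup>2 * W y) + K * (y ^ 4 * W y))
       = (\<lambda>y. (e / 2 + K * (y\<^sup>2 - x0\<^sup>2)\<^sup>2) * W y)"
      by (auto simp: fun_eq_iff power2_eq_square power4_eq_xxxx algebra_simps)
    also have "(e / 2 + K * x0 ^ 4) * Z - 2 * K * x0\<^sup>2 * (Z * ((\<nu> + 1 + l i / a i) / a i)) +
         K * (Z * (((\<nu> + 1) * (\<nu> + 2) + (2 * \<nu> + 4) * (l i / a i) + (l i / a i)\<^sup>2) / (a i)\<^sup>2))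
       = Z * (e / 2 + K * V i)"
      unfolding V_def by (simp add: algebra_simps)
    finally have B: "has_bochner_integral lborel (\<lambda>y. (e / 2 + K * (y\<^sup>2 - x0\<^sup>2)\<^sup>2) * W y) (Z * (e / 2 + K * V i))" .
    have int1: "integrable lborel (\<lambda>y. \<psi> y * W y)"
    proof (rule Bochner_Integration.integrable_bound)
      show "integrable lborel (\<lambda>y. M * W y)"
        using m(1)[THEN has_bochner_integral_iff[THEN iffD1], THEN conjunct1] by simp
      show "AE y in lborel. norm (\<psi> y * W y) \<le> norm (M * W y)"
        using M M0 W0 by (auto simp: abs_mult intro!: mult_right_mono)
    qed simp
    have "(\<integral>y. (\<psi> y - \<psi> x0) * W y \<partial>lborel) = (\<integral>y. \<psi> y * W y \<partial>lborel) - \<psi> x0 * Z"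
      using int1 m(1)[THEN has_bochner_integral_iff[THEN iffD1], THEN conjunct1] has_bochner_integral_integral_eq[OF m(1)]
      by (simp add: left_diff_distrib)
    moreover have "c * (\<psi> x0 * Z) = \<psi> x0" using cZ by simp
    ultimately have "c * (\<integral>y. \<psi> y * W y \<partial>lborel) - \<psi> x0 = c * (\<integral>y. (\<psi> y - \<psi> x0) * W y \<partial>lborel)"
      by (simp add: right_diff_distrib)
    moreover have "norm (\<integral>y. (\<psi> y - \<psi> x0) * W y \<partial>lborel) \<le> (\<integral>y. (e / 2 + K * (y\<^sup>2 - x0\<^sup>2)\<^sup>2) * W y \<partial>lborel)"
    proof (rule Bochner_Integration.integral_norm_bound_integral)
      show "integrable lborel (\<lambda>y. (\<psi> y - \<psi> x0) * W y)"
        using int1 m(1)[THEN has_bochner_integral_iff[THEN iffD1], THEN conjunct1] by (simp add: left_diff_distrib)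
      show "integrable lborel (\<lambda>y. (e / 2 + K * (y\<^sup>2 - x0\<^sup>2)\<^sup>2) * W y)"
        using B by (simp add: has_bochner_integral_iff)
      \<comment> \<open>The bound on \<psi> is available for y > 0 only; elsewhere the weight is
        zero.\<close>
      show "norm ((\<psi> y - \<psi> x0) * W y) \<le> (e / 2 + K * (y\<^sup>2 - x0\<^sup>2)\<^sup>2) * W y" for y
      proof (cases "y > 0")
        case True
        then show ?thesis using bound W0 by (simp add: abs_mult mult_right_mono)
      qed (simp add: W_def bessel_weight_def)
    qed
    ultimately have "\<bar>c * (\<integral>y. \<psi> y * W y \<partial>lborel) - \<psi> x0\<bar> \<le> c * (Z * (e / 2 + K * V i))"
      unfolding has_bochner_integral_integral_eq[OF B] using cZ(2) by (simp add: abs_mult)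
    also have "\<dots> = e / 2 + K * V i" using cZ(1) by (simp flip: mult.assoc)
    also have "\<dots> < e" using elim by simp
    finally show ?case by (simp add: dist_real_def c_def W_def)
  qed
qed

section \<open>The differential equation\<close>

text \<open>Since y runs over a compact interval, joint continuity suffices both for Leibniz's rule
  and for the continuity in (t, x) that a classical solution needs. The equation then passes under
  the integral by linearity.\<close>

lemma solves_pde_superposition:
  fixes k kt kx kxx :: "real \<Rightarrow> real \<Rightarrow> real \<Rightarrow> real"
  assumes cont:
      "continuous_on (({0<..} \<times> {0<..}) \<times> {a..b}) (\<lambda>((t, x), y). k t x y)"
      "continuous_on (({0<..} \<times> {0<..}) \<times> {a..b}) (\<lambda>((t, x), y). kt t x y)"
      "continuous_on (({0<..} \<times> {0<..}) \<times> {a..b}) (\<lambda>((t, x), y). kx t x y)"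
      "continuous_on (({0<..} \<times> {0<..}) \<times> {a..b}) (\<lambda>((t, x), y). kxx t x y)"
    and deriv:
      "\<And>t x y. t > 0 \<Longrightarrow> x > 0 \<Longrightarrow> y \<in> {a..b} \<Longrightarrow> ((\<lambda>s. k s x y) has_real_derivative kt t x y) (at t)"
      "\<And>t x y. t > 0 \<Longrightarrow> x > 0 \<Longrightarrow> y \<in> {a..b} \<Longrightarrow> ((\<lambda>z. k t z y) has_real_derivative kx t x y) (at x)"
      "\<And>t x y. t > 0 \<Longrightarrow> x > 0 \<Longrightarrow> y \<in> {a..b} \<Longrightarrow> ((\<lambda>z. kx t z y) has_real_derivative kxx t x y) (at x)"
    and pde: "\<And>t x y. t > 0 \<Longrightarrow> x > 0 \<Longrightarrow> y \<in> {a..b} \<Longrightarrow>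
        kt t x y = \<sigma> * kxx t x y + f x * kx t x y - \<mu> * x\<^sup>2 * k t x y"
    and u: "\<And>t x. t > 0 \<Longrightarrow> x > 0 \<Longrightarrow> u t x = integral {a..b} (k t x)"
  shows "solves_pde \<sigma> f \<mu> u"
proof -
  have param: "continuous_on ({0<..} \<times> {0<..}) (\<lambda>(t, x). integral {a..b} (g t x))"
    if "continuous_on (({0<..} \<times> {0<..}) \<times> {a..b}) (\<lambda>((t, x), y). g t x y)" for g :: "real \<Rightarrow> real \<Rightarrow> real \<Rightarrow> real"
    using integral_continuous_on_param[of "{0<..} \<times> {0<..}" a b "\<lambda>(t, x). g t x"] that
    by (simp add: case_prod_unfold)
  have slice_t: "continuous_on ({0<..} \<times> cbox a b) (\<lambda>(s, y). g s x y)"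
    and slice_x: "continuous_on ({0<..} \<times> cbox a b) (\<lambda>(z, y). g t z y)"
    and int: "g t x integrable_on {a..b}"
    if g: "continuous_on (({0<..} \<times> {0<..}) \<times> {a..b}) (\<lambda>((t, x), y). g t x y)" and "t > 0" "x > 0"
    for t x and g :: "real \<Rightarrow> real \<Rightarrow> real \<Rightarrow> real"
  proof -
    have "continuous_on ({0<..} \<times> cbox a b) (\<lambda>p. (\<lambda>((t, x), y). g t x y) ((fst p, x), snd p))"
      by (rule continuous_on_compose2[OF g]) (use \<open>x > 0\<close> in \<open>auto intro!: continuous_intros\<close>)
    then show "continuous_on ({0<..} \<times> cbox a b) (\<lambda>(s, y). g s x y)"
      by (simp add: case_prod_unfold)
    have "continuous_on ({0<..} \<times> cbox a b) (\<lambda>p. (\<lambda>((t, x), y). g t x y) ((t, fst p), snd p))"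
      by (rule continuous_on_compose2[OF g]) (use \<open>t > 0\<close> in \<open>auto intro!: continuous_intros\<close>)
    then show "continuous_on ({0<..} \<times> cbox a b) (\<lambda>(z, y). g t z y)"
      by (simp add: case_prod_unfold)
    have "continuous_on {a..b} (\<lambda>y. (\<lambda>((t, x), y). g t x y) ((t, x), y))"
      by (rule continuous_on_compose2[OF g]) (use that in \<open>auto intro!: continuous_intros\<close>)
    then show "g t x integrable_on {a..b}"
      by (auto intro!: integrable_continuous_interval)
  qed
  have leibniz: "((\<lambda>s. integral {a..b} (g s)) has_real_derivative integral {a..b} (gs s0)) (at s0)"
    if "\<And>s y. s > 0 \<Longrightarrow> y \<in> {a..b} \<Longrightarrow> ((\<lambda>s. g s y) has_real_derivative gs s y) (at s)"
      "\<And>s. s > 0 \<Longrightarrow> g s integrable_on {a..b}"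
      "continuous_on ({0<..} \<times> cbox a b) (\<lambda>(s, y). gs s y)" "s0 > 0" for g gs s0
  proof -
    \<comment> \<open>Leibniz's rule is applied on the half-line, which is convex and open, so the
      derivative within it is the full derivative.\<close>
    have "((\<lambda>s. integral (cbox a b) (g s)) has_real_derivative integral (cbox a b) (gs s0)) (at s0 within {0<..})"
      using that by (intro leibniz_rule_field_derivative) (auto intro: has_field_derivative_at_within)
    then show ?thesis using that(4) by (simp add: at_within_open[of _ "{0<..}"])
  qed
  show ?thesis
    unfolding solves_pde_def
  proof (rule exI[of _ "\<lambda>t x. integral {a..b} (kt t x)"], rule exI[of _ "\<lambda>t x. integral {a..b} (kx t x)"],
      rule exI[of _ "\<lambda>t x. integral {a..b} (kxx t x)"], intro conjI allI impI param cont)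
    fix t x :: real assume tx: "t > 0" "x > 0"
    have "((\<lambda>s. integral {a..b} (k s x)) has_real_derivative integral {a..b} (kt t x)) (at t)"
      using tx deriv(1) int[OF cont(1)] slice_t[OF cont(2)] by (intro leibniz) auto
    then show "((\<lambda>s. u s x) has_real_derivative integral {a..b} (kt t x)) (at t)"
      by (rule has_field_derivative_transform_within_open[where S = "{0<..}"]) (use tx u in auto)
    have "((\<lambda>z. integral {a..b} (k t z)) has_real_derivative integral {a..b} (kx t x)) (at x)"
      using tx deriv(2) int[OF cont(1)] slice_x[OF cont(3)] by (intro leibniz) auto
    then show "((\<lambda>z. u t z) has_real_derivative integral {a..b} (kx t x)) (at x)"
      by (rule has_field_derivative_transform_within_open[where S = "{0<..}"]) (use tx u in auto)
    show "((\<lambda>z. integral {a..b} (kx t z)) has_real_derivative integral {a..b} (kxx t x)) (at x)"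
      using tx deriv(3) int[OF cont(3)] slice_x[OF cont(4)] by (intro leibniz) auto
    note i = int[OF cont(1) tx] int[OF cont(3) tx] int[OF cont(4) tx]
    have "integral {a..b} (kt t x) = integral {a..b} (\<lambda>y. \<sigma> * kxx t x y + f x * kx t x y - \<mu> * x\<^sup>2 * k t x y)"
      using pde[OF tx] by (intro integral_cong) auto
    also have "\<dots> = \<sigma> * integral {a..b} (kxx t x) + f x * integral {a..b} (kx t x) - \<mu> * x\<^sup>2 * integral {a..b} (k t x)"
      by (intro integral_unique has_integral_diff has_integral_add has_integral_mult_right integrable_integral i)
    finally show "integral {a..b} (kt t x) =
        \<sigma> * integral {a..b} (kxx t x) + f x * integral {a..b} (kx t x) - \<mu> * x\<^sup>2 * u t x"
      using u[OF tx] by simp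
  qed
qed

text \<open>The hyperbolic functions enter only through three relations for r and a: two give the
  time derivative of the kernel, the third matches the coefficients of x^2. The Riccati equation and
  the choice of \<beta> account for the terms in f, B, C and \<mu>.\<close>

lemma bessel_kernel_solves_pde:
  fixes a r f F g :: "real \<Rightarrow> real" and \<sigma> \<mu> A B C \<beta> p q :: real
  assumes \<sigma>: "\<sigma> > 0" and pq: "0 < p" and \<beta>: "\<beta> \<ge> 0" "\<beta>\<^sup>2 = 1/4 + C / (2 * \<sigma>\<^sup>2)"
    and r: "\<And>t. t > 0 \<Longrightarrow> r t > 0"
    and dr: "\<And>t. t > 0 \<Longrightarrow> (r has_real_derivative - 4 * \<sigma> * a t * r t) (at t)"
    and da: "\<And>t. t > 0 \<Longrightarrow> (a has_real_derivative - \<sigma> * (r t)\<^sup>2) (at t)"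
    and ar: "\<And>t. t > 0 \<Longrightarrow> A = 64 * \<sigma>\<^sup>2 * (a t)\<^sup>2 - 16 * \<sigma>\<^sup>2 * (r t)\<^sup>2"
    and diff: "\<And>x. x > 0 \<Longrightarrow> f differentiable (at x)"
    and ric: "\<And>x. x > 0 \<Longrightarrow>
           \<sigma> * deriv f x + 1/2 * (f x)\<^sup>2 = C / x\<^sup>2 + B / 2 + 1/8 * (A - 16 * \<mu> * \<sigma>) * x\<^sup>2"
    and F: "\<And>x. x > 0 \<Longrightarrow> (F has_real_derivative f x) (at x)"
    and g: "continuous_on {p..q} g"
    and u: "\<And>t x. t > 0 \<Longrightarrow> x > 0 \<Longrightarrow> u t x = integral {p..q} (\<lambda>y. g y *
        (r t * exp (- (B * t / (4 * \<sigma>)) - F x / (2 * \<sigma>) - a t * (x\<^sup>2 + y\<^sup>2)) * sqrt x * bessel_I \<beta> (r t * x * y)))"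
  shows "solves_pde \<sigma> f \<mu> u"
proof -
  define E where "E t x y = g y * (r t * exp (- (B * t / (4 * \<sigma>)) - F x / (2 * \<sigma>) - a t * (x\<^sup>2 + y\<^sup>2)) * sqrt x)"
    for t x y
  \<comment> \<open>The logarithmic derivative of E in x, and below it its own derivative. Then kt,
    kx and kxx are the product rule for E times the Bessel factor.\<close>
  define L where "L t x = - f x / (2 * \<sigma>) + 1 / (2 * x) - 2 * a t * x" for t x
  define Lx where "Lx t x = - deriv f x / (2 * \<sigma>) - 1 / (2 * x\<^sup>2) - 2 * a t" for t x
  define kt where "kt t x y = E t x y * ((- B / (4 * \<sigma>) + \<sigma> * (r t)\<^sup>2 * (x\<^sup>2 + y\<^sup>2) - 4 * \<sigma> * a t) * bessel_I \<beta> (r t * x * y)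
      - 4 * \<sigma> * a t * r t * x * y * bessel_I' \<beta> (r t * x * y))" for t x y
  define kx where "kx t x y = E t x y * (L t x * bessel_I \<beta> (r t * x * y) + r t * y * bessel_I' \<beta> (r t * x * y))" for t x y
  define kxx where "kxx t x y = E t x y * (((L t x)\<^sup>2 + Lx t x) * bessel_I \<beta> (r t * x * y)
      + 2 * L t x * (r t * y) * bessel_I' \<beta> (r t * x * y) + (r t * y)\<^sup>2 * bessel_I'' \<beta> (r t * x * y))" for t x y
  have df: "(f has_real_derivative deriv f x) (at x)" if "x > 0" for x
    using diff[OF that] by (simp add: DERIV_deriv_iff_real_differentiable)
  have f': "deriv f x = (C / x\<^sup>2 + B / 2 + 1/8 * (A - 16 * \<mu> * \<sigma>) * x\<^sup>2 - 1/2 * (f x)\<^sup>2) / \<sigma>" if "x > 0" for x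
    using ric[OF that] \<sigma> by (simp add: field_simps)
  have cf: "continuous_on {0<..} f"
    by (rule DERIV_continuous_on[OF has_field_derivative_at_within[OF df]]) simp
  \<comment> \<open>Continuity of the second x-derivative needs \<open>deriv f\<close> continuous,
    while f is only assumed differentiable. The Riccati equation expresses \<open>deriv f\<close>
    through f itself.\<close>
  have cf': "continuous_on {0<..} (deriv f)"
  proof (subst continuous_on_cong[OF refl])
    show "continuous_on {0<..} (\<lambda>x. (C / x\<^sup>2 + B / 2 + 1/8 * (A - 16 * \<mu> * \<sigma>) * x\<^sup>2 - 1/2 * (f x)\<^sup>2) / \<sigma>)"
      using \<sigma> by (intro continuous_intros cf) auto
  qed (use f' in auto)
  have cF: "continuous_on {0<..} F"
    by (rule DERIV_continuous_on[OF has_field_derivative_at_within[OF F]]) simp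
  have ca: "continuous_on {0<..} a"
    by (rule DERIV_continuous_on[OF has_field_derivative_at_within[OF da]]) simp
  have cr: "continuous_on {0<..} r"
    by (rule DERIV_continuous_on[OF has_field_derivative_at_within[OF dr]]) simp
  let ?D = "({0<..} \<times> {0<..}) \<times> {p..q} :: ((real \<times> real) \<times> real) set"
  have z: "r t * x * y > 0" if "t > 0" "x > 0" "y \<in> {p..q}" for t x y
    using r that pq by simp
  have cd: "continuous_on ?D (\<lambda>w. a (fst (fst w)))" "continuous_on ?D (\<lambda>w. r (fst (fst w)))"
    "continuous_on ?D (\<lambda>w. f (snd (fst w)))" "continuous_on ?D (\<lambda>w. deriv f (snd (fst w)))"
    "continuous_on ?D (\<lambda>w. F (snd (fst w)))" "continuous_on ?D (\<lambda>w. g (snd w))"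
    by (rule continuous_on_compose2[OF ca] continuous_on_compose2[OF cr] continuous_on_compose2[OF cf]
        continuous_on_compose2[OF cf'] continuous_on_compose2[OF cF] continuous_on_compose2[OF g];
        auto intro!: continuous_intros)+
  have cb: "continuous_on ?D (\<lambda>w. h (r (fst (fst w)) * snd (fst w) * snd w))"
    if "continuous_on {0<..} h" for h :: "real \<Rightarrow> real"
    by (rule continuous_on_compose2[OF that]) (auto intro!: continuous_intros cd simp: r pq less_le_trans[OF pq])
  note cb' = cb[OF continuous_on_bessel_I(1)[OF \<beta>(1)]] cb[OF continuous_on_bessel_I(2)[OF \<beta>(1)]]
    cb[OF continuous_on_bessel_I(3)[OF \<beta>(1)]]
  have cE: "continuous_on ?D (\<lambda>w. E (fst (fst w)) (snd (fst w)) (snd w))"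
    unfolding E_def using \<sigma> by (intro continuous_intros cd) auto
  have cL: "continuous_on ?D (\<lambda>w. L (fst (fst w)) (snd (fst w)))"
    "continuous_on ?D (\<lambda>w. Lx (fst (fst w)) (snd (fst w)))"
    unfolding L_def Lx_def using \<sigma> by (intro continuous_intros cd; auto)+
  have dE: "((\<lambda>s. E s x y) has_real_derivative
        E t x y * (- B / (4 * \<sigma>) + \<sigma> * (r t)\<^sup>2 * (x\<^sup>2 + y\<^sup>2) - 4 * \<sigma> * a t)) (at t)"
    "((\<lambda>z. E t z y) has_real_derivative E t x y * L t x) (at x)"
    "(L t has_real_derivative Lx t x) (at x)" if "t > 0" "x > 0" for t x y
  proof -
    show "((\<lambda>s. E s x y) has_real_derivative
        E t x y * (- B / (4 * \<sigma>) + \<sigma> * (r t)\<^sup>2 * (x\<^sup>2 + y\<^sup>2) - 4 * \<sigma> * a t)) (at t)"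
      unfolding E_def using that \<sigma>
      by (auto intro!: derivative_eq_intros dr da simp: algebra_simps power2_eq_square)
    have s: "inverse (sqrt x) = sqrt x / x"
      using that by (simp add: field_simps)
    show "((\<lambda>z. E t z y) has_real_derivative E t x y * L t x) (at x)"
      unfolding E_def L_def using that \<sigma>
      by (auto intro!: derivative_eq_intros F simp: s algebra_simps divide_simps)
    show "(L t has_real_derivative Lx t x) (at x)"
      unfolding L_def Lx_def using that \<sigma>
      by (auto intro!: derivative_eq_intros df simp: field_simps power2_eq_square)
  qed
  show ?thesis
  proof (rule solves_pde_superposition[where a = p and b = q and k = "\<lambda>t x y. E t x y * bessel_I \<beta> (r t * x * y)"
        and kt = kt and kx = kx and kxx = kxx])
    show "continuous_on ?D (\<lambda>((t, x), y). E t x y * bessel_I \<beta> (r t * x * y))"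
      unfolding case_prod_unfold by (intro continuous_intros cE cb')
    show "continuous_on ?D (\<lambda>((t, x), y). kt t x y)"
      unfolding case_prod_unfold kt_def using \<sigma> by (intro continuous_intros cE cb' cd) auto
    show "continuous_on ?D (\<lambda>((t, x), y). kx t x y)"
      unfolding case_prod_unfold kx_def by (intro continuous_intros cE cb' cd cL)
    show "continuous_on ?D (\<lambda>((t, x), y). kxx t x y)"
      unfolding case_prod_unfold kxx_def by (intro continuous_intros cE cb' cd cL)
    fix t x y :: real assume h: "t > 0" "x > 0" "y \<in> {p..q}"
    note zpos = z[OF h]
    have dI: "(bessel_I \<beta> has_real_derivative bessel_I' \<beta> (r t * x * y)) (at (r t * x * y))"
      using bessel_I_deriv[OF \<beta>(1) zpos] by (simp add: bessel_I'_def)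
    note dI' = bessel_I'_deriv[OF \<beta>(1) zpos]
    have dt: "((\<lambda>s. r s * x * y) has_real_derivative - 4 * \<sigma> * a t * r t * x * y) (at t)"
      using h by (auto intro!: derivative_eq_intros dr)
    have dx: "((\<lambda>z. r t * z * y) has_real_derivative r t * y) (at x)"
      by (auto intro!: derivative_eq_intros)
    show "((\<lambda>s. E s x y * bessel_I \<beta> (r s * x * y)) has_real_derivative kt t x y) (at t)"
      by (rule DERIV_cong[OF DERIV_mult[OF dE(1)[OF h(1,2)] DERIV_chain2[OF dI dt]]])
        (simp add: kt_def algebra_simps)
    show "((\<lambda>z. E t z y * bessel_I \<beta> (r t * z * y)) has_real_derivative kx t x y) (at x)"
      by (rule DERIV_cong[OF DERIV_mult[OF dE(2)[OF h(1,2)] DERIV_chain2[OF dI dx]]])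
        (simp add: kx_def algebra_simps)
    show "((\<lambda>z. kx t z y) has_real_derivative kxx t x y) (at x)"
      unfolding kx_def
      by (rule DERIV_cong[OF DERIV_mult[OF dE(2)[OF h(1,2)] DERIV_add[OF DERIV_mult[OF dE(3)[OF h(1,2)] DERIV_chain2[OF dI dx]]
            DERIV_cmult[OF DERIV_chain2[OF dI' dx]]]]])
        (simp add: kxx_def algebra_simps power2_eq_square)
    define J where "J = bessel_I \<beta> (r t * x * y)"
    define J' where "J' = bessel_I' \<beta> (r t * x * y)"
    have y: "y > 0" using h pq by simp
    \<comment> \<open>Bessel's equation removes the second derivative, so the PDE becomes an
      identity linear in J and J', checked on the two coefficients \<open>c0\<close> and
      \<open>c1\<close>.\<close>
    have J'': "(r t * y)\<^sup>2 * bessel_I'' \<beta> (r t * x * y) = ((r t)\<^sup>2 * y\<^sup>2 + \<beta>\<^sup>2 / x\<^sup>2) * J - r t * y / x * J'"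
      using h y r[OF h(1)] by (simp add: bessel_I''_def J_def J'_def field_simps power2_eq_square)
    have C: "C = 2 * \<sigma>\<^sup>2 * (\<beta>\<^sup>2 - 1/4)" using \<beta>(2) \<sigma> by simp
    \<comment> \<open>Coefficient of J: inserting \<open>deriv f\<close> and C cancels the terms in
      1 / x^2 and in f, and the relation \<open>ar\<close> matches those in x^2.\<close>
    have c0: "- B / (4 * \<sigma>) + \<sigma> * (r t)\<^sup>2 * (x\<^sup>2 + y\<^sup>2) - 4 * \<sigma> * a t =
        \<sigma> * ((L t x)\<^sup>2 + Lx t x + (r t)\<^sup>2 * y\<^sup>2 + \<beta>\<^sup>2 / x\<^sup>2) + f x * L t x - \<mu> * x\<^sup>2"
      unfolding L_def Lx_def f'[OF h(2)] C ar[OF h(1)] using h \<sigma>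
      by (simp add: field_simps power2_eq_square)
    \<comment> \<open>Coefficient of J': the terms in f and in 1 / x cancel, leaving that of
      a.\<close>
    have c1: "- 4 * \<sigma> * a t * r t * x * y = \<sigma> * (2 * L t x * (r t * y) - r t * y / x) + f x * (r t * y)"
      unfolding L_def using h \<sigma> by (simp add: field_simps)
    have "(- B / (4 * \<sigma>) + \<sigma> * (r t)\<^sup>2 * (x\<^sup>2 + y\<^sup>2) - 4 * \<sigma> * a t) * J - 4 * \<sigma> * a t * r t * x * y * J' =
        (- B / (4 * \<sigma>) + \<sigma> * (r t)\<^sup>2 * (x\<^sup>2 + y\<^sup>2) - 4 * \<sigma> * a t) * J + (- 4 * \<sigma> * a t * r t * x * y) * J'"
      by simp
    also have "\<dots> = \<sigma> * (((L t x)\<^sup>2 + Lx t x) * J + 2 * L t x * (r t * y) * J' + (r t * y)\<^sup>2 * bessel_I'' \<beta> (r t * x * y))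
        + f x * (L t x * J + r t * y * J') - \<mu> * x\<^sup>2 * J"
      unfolding c0 c1 J'' by (simp add: algebra_simps)
    finally have bracket: "(- B / (4 * \<sigma>) + \<sigma> * (r t)\<^sup>2 * (x\<^sup>2 + y\<^sup>2) - 4 * \<sigma> * a t) * J - 4 * \<sigma> * a t * r t * x * y * J' =
        \<sigma> * (((L t x)\<^sup>2 + Lx t x) * J + 2 * L t x * (r t * y) * J' + (r t * y)\<^sup>2 * bessel_I'' \<beta> (r t * x * y))
        + f x * (L t x * J + r t * y * J') - \<mu> * x\<^sup>2 * J" .
    show "kt t x y = \<sigma> * kxx t x y + f x * kx t x y - \<mu> * x\<^sup>2 * (E t x y * bessel_I \<beta> (r t * x * y))"
      unfolding kt_def kx_def kxx_def J_def[symmetric] J'_def[symmetric] bracket by (simp add: algebra_simps)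
  next
    fix t x :: real assume "t > 0" "x > 0"
    then show "u t x = integral {p..q} (\<lambda>y. E t x y * bessel_I \<beta> (r t * x * y))"
      using u by (simp add: E_def mult.assoc)
  qed
qed

section \<open>The fundamental solution\<close>

theorem theorem5p11:
  fixes \<sigma> \<mu> A B C \<beta> :: real and f F :: "real \<Rightarrow> real"
  assumes "\<sigma> > 0" and "A > 0"
    and "\<And>x. x > 0 \<Longrightarrow> f differentiable (at x)"
    and "\<And>x. x > 0 \<Longrightarrow>
           \<sigma> * deriv f x + 1/2 * (f x)\<^sup>2 = C / x\<^sup>2 + B / 2 + 1/8 * (A - 16 * \<mu> * \<sigma>) * x\<^sup>2"
    and "\<And>x. x > 0 \<Longrightarrow> (F has_real_derivative f x) (at x)"
    and "\<beta> = 1/2 * sqrt (1 + 2 * C / \<sigma>\<^sup>2)"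
  shows "\<exists>C1 C2 :: real \<Rightarrow> real. fundamental_solution \<sigma> f \<mu>
           (\<lambda>t x y. sqrt (A * x * y) / (2 * sinh (sqrt A * t / 2))
              * exp (- (B * t / (4 * \<sigma>)) + (F y - F x) / (2 * \<sigma>)
                     - sqrt A * (x\<^sup>2 + y\<^sup>2) / (8 * \<sigma> * tanh (sqrt A * t / 2)))
              * (C1 y * bessel_I \<beta> (sqrt A * x * y / (4 * \<sigma> * sinh (sqrt A * t / 2)))
                 + C2 y * bessel_I_neg \<beta> (sqrt A * x * y / (4 * \<sigma> * sinh (sqrt A * t / 2)))))"
proof -
  note \<sigma> = assms(1) and A = assms(2) and F = assms(5)
  have "1 + 2 * C / \<sigma>\<^sup>2 \<ge> 0"
    using assms(3,4) by (rule riccati_nonoscillation[OF \<sigma>])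
  then have \<beta>: "\<beta> \<ge> 0" "\<beta>\<^sup>2 = 1/4 + C / (2 * \<sigma>\<^sup>2)"
    by (simp_all add: assms(6) power_mult_distrib power_divide)

  \<comment> \<open>The time coefficients and the form of the kernel\<close>
  define r where "r t = sqrt A / (4 * \<sigma> * sinh (sqrt A * t / 2))" for t
  define a where "a t = sqrt A / (8 * \<sigma> * tanh (sqrt A * t / 2))" for t
  have a_eq: "a t = sqrt A * cosh (sqrt A * t / 2) / (8 * \<sigma> * sinh (sqrt A * t / 2))" for t
    by (simp add: a_def tanh_def)
  have sh: "sinh (sqrt A * t / 2) > 0" if "t > 0" for t using A that by simp
  have r: "r t > 0" if "t > 0" for t using sh[OF that] \<sigma> A by (simp add: r_def)
  have a: "a t > 0" if "t > 0" for t using sh[OF that] \<sigma> A by (simp add: a_eq)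
  have dr: "(r has_real_derivative - 4 * \<sigma> * a t * r t) (at t)" if "t > 0" for t
    unfolding r_def a_eq using sh[OF that] \<sigma> A
    by (auto intro!: derivative_eq_intros simp: field_simps power2_eq_square)
  have "((\<lambda>t. sqrt A * cosh (sqrt A * t / 2) / (8 * \<sigma> * sinh (sqrt A * t / 2))) has_real_derivative - \<sigma> * (r t)\<^sup>2) (at t)"
    if "t > 0" for t
    unfolding r_def using sh[OF that] \<sigma> A cosh_square_eq[of "sqrt A * t / 2"]
    by (auto intro!: derivative_eq_intros simp: field_simps power2_eq_square)
  then have da: "(a has_real_derivative - \<sigma> * (r t)\<^sup>2) (at t)" if "t > 0" for t
    using that by (simp add: a_eq[abs_def])
  have ar: "A = 64 * \<sigma>\<^sup>2 * (a t)\<^sup>2 - 16 * \<sigma>\<^sup>2 * (r t)\<^sup>2" if "t > 0" for t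
    unfolding r_def a_eq using sh[OF that] that \<sigma> A cosh_square_eq[of "sqrt A * t / 2"]
    by (simp add: power_mult_distrib power_divide field_simps)
  \<comment> \<open>The values C1 = 1 / (2 \<sigma>) and C2 = 0 are written in place, so that the
    final existential introduction matches literally.\<close>
  define P where "P t x y = sqrt (A * x * y) / (2 * sinh (sqrt A * t / 2))
              * exp (- (B * t / (4 * \<sigma>)) + (F y - F x) / (2 * \<sigma>)
                     - sqrt A * (x\<^sup>2 + y\<^sup>2) / (8 * \<sigma> * tanh (sqrt A * t / 2)))
              * (1 / (2 * \<sigma>) * bessel_I \<beta> (sqrt A * x * y / (4 * \<sigma> * sinh (sqrt A * t / 2)))
                 + 0 * bessel_I_neg \<beta> (sqrt A * x * y / (4 * \<sigma> * sinh (sqrt A * t / 2))))" for t x y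
  have P_eq: "P t x y = sqrt y * exp (F y / (2 * \<sigma>)) *
      (r t * exp (- (B * t / (4 * \<sigma>)) - F x / (2 * \<sigma>) - a t * (x\<^sup>2 + y\<^sup>2)) * sqrt x * bessel_I \<beta> (r t * x * y))"
    if "t > 0" for t x y
  proof -
    \<comment> \<open>The origin of C1: the factor 1 / (2 \<sigma>) turns the given prefactor into r
      t, the normalisation for which the initial value is exactly \<phi>.\<close>
    have 1: "sqrt (A * x * y) / (2 * sinh (sqrt A * t / 2)) * (1 / (2 * \<sigma>)) = r t * sqrt x * sqrt y"
      using \<sigma> by (simp add: r_def real_sqrt_mult field_simps)
    have 2: "- (B * t / (4 * \<sigma>)) + (F y - F x) / (2 * \<sigma>) - sqrt A * (x\<^sup>2 + y\<^sup>2) / (8 * \<sigma> * tanh (sqrt A * t / 2))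
       = F y / (2 * \<sigma>) + (- (B * t / (4 * \<sigma>)) - F x / (2 * \<sigma>) - a t * (x\<^sup>2 + y\<^sup>2))"
      by (simp add: a_def diff_divide_distrib)
    have "P t x y = (sqrt (A * x * y) / (2 * sinh (sqrt A * t / 2)) * (1 / (2 * \<sigma>))) *
      exp (F y / (2 * \<sigma>) + (- (B * t / (4 * \<sigma>)) - F x / (2 * \<sigma>) - a t * (x\<^sup>2 + y\<^sup>2))) * bessel_I \<beta> (r t * x * y)"
      unfolding P_def 2 by (simp add: r_def)
    then show ?thesis unfolding 1 exp_add by simp
  qed
  have cF: "continuous_on {0<..} F"
    by (rule DERIV_continuous_on[OF has_field_derivative_at_within[OF F]]) simp
  have "fundamental_solution \<sigma> f \<mu> P"
    unfolding fundamental_solution_def Let_def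
  proof (intro allI impI)

    \<comment> \<open>Integrability and the equation for compactly supported data\<close>
    fix \<phi> assume "test_data \<phi>"
    then obtain K where c\<phi>: "continuous_on {0<..} \<phi>" and K: "compact K" "K \<subseteq> {0<..}" "\<forall>y>0. y \<notin> K \<longrightarrow> \<phi> y = 0"
      unfolding test_data_def by blast
    \<comment> \<open>The support lies in an interval bounded away from 0, so the integral over the
      half-line becomes one over a compact interval. An empty K has no extremal points and gets an
      arbitrary interval.\<close>
    obtain p q where pq: "0 < p" "K \<subseteq> {p..q}"
    proof (cases "K = {}")
      case True
      then show ?thesis using that[of 1 1] by simp
    next
      case False
      obtain p where p: "p \<in> K" "\<And>y. y \<in> K \<Longrightarrow> p \<le> y"
        using compact_attains_inf[OF K(1) False] by blast
      obtain q where q: "\<And>y. y \<in> K \<Longrightarrow> y \<le> q"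
        using compact_attains_sup[OF K(1) False] by blast
      from p q K(2) show ?thesis by (intro that[of p q]) auto
    qed
    have sub: "{p..q} \<subseteq> {0<..}" using pq by auto
    have supp: "\<phi> y = 0" if "y > 0" "y \<notin> {p..q}" for y
      using K(3) that pq by blast
    let ?g = "\<lambda>y. \<phi> y * (sqrt y * exp (F y / (2 * \<sigma>)))"
    let ?k = "\<lambda>t x y. ?g y * (r t * exp (- (B * t / (4 * \<sigma>)) - F x / (2 * \<sigma>) - a t * (x\<^sup>2 + y\<^sup>2)) * sqrt x * bessel_I \<beta> (r t * x * y))"
    let ?u = "\<lambda>t x. LINT y:{0<..}|lborel. \<phi> y * P t x y"
    have cg: "continuous_on {p..q} ?g"
      using \<sigma> by (intro continuous_intros continuous_on_subset[OF c\<phi> sub] continuous_on_subset[OF cF sub]) auto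
    have ind: "indicator {0<..} y *\<^sub>R (\<phi> y * P t x y) = indicator {p..q} y *\<^sub>R ?k t x y" if "t > 0" for t x y
      using supp[of y] sub pq(1) P_eq[OF that] by (auto simp: indicator_def)
    have ck: "set_integrable lborel {p..q} (?k t x)" if "t > 0" "x > 0" for t x
    proof (rule borel_integrable_atLeastAtMost')
      have "continuous_on {p..q} (\<lambda>y. bessel_I \<beta> (r t * x * y))"
        by (rule continuous_on_compose2[OF continuous_on_bessel_I(1)[OF \<beta>(1)]])
          (use r that pq in \<open>auto intro!: continuous_intros simp del: image_mult_atLeastAtMost simp: image_subset_iff\<close>)
      then show "continuous_on {p..q} (?k t x)"
        by (intro continuous_intros cg)
    qed
    have int: "set_integrable lborel {0<..} (\<lambda>y. \<phi> y * P t x y)" if "t > 0" "x > 0" for t x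
      using ck[OF that] by (simp only: set_integrable_def ind[OF that(1)])
    have u_eq: "?u t x = integral {p..q} (?k t x)" if "t > 0" "x > 0" for t x
      using set_borel_integral_eq_integral(2)[OF ck[OF that]]
      by (simp only: set_lebesgue_integral_def ind[OF that(1)])
    have pde: "solves_pde \<sigma> f \<mu> ?u"
      by (rule bessel_kernel_solves_pde[OF \<sigma> pq(1) \<beta> r dr da ar assms(3) assms(4) F cg u_eq])

    \<comment> \<open>The initial condition\<close>
    have init: "((\<lambda>(t, x). ?u t x) \<longlongrightarrow> \<phi> x0) (at (0, x0) within {0<..} \<times> {0<..})" if x0: "x0 > 0" for x0
    proof -
      let ?F = "at (0, x0) within {0<..} \<times> {0<..} :: (real \<times> real) filter"
      \<comment> \<open>In y the kernel brings the power 1/2 from its prefactor and \<beta> from the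
        Bessel function, the weight has 2 \<beta> + 1; the negative power in \<psi> is the
        difference. It is harmless because \<phi> vanishes near 0.\<close>
      define \<psi> where "\<psi> y = indicator {0<..} y *\<^sub>R (\<phi> y * y powr (- \<beta> - 1/2) * exp (F y / (2 * \<sigma>)))" for y
      have c\<psi>': "continuous_on {0<..} (\<lambda>y. \<phi> y * y powr (- \<beta> - 1/2) * exp (F y / (2 * \<sigma>)))"
        using \<sigma> by (intro continuous_intros c\<phi> cF) auto
      have c\<psi>: "continuous_on {0<..} \<psi>"
        by (subst continuous_on_cong[OF refl _, of _ _ "\<lambda>y. \<phi> y * y powr (- \<beta> - 1/2) * exp (F y / (2 * \<sigma>))"])
          (auto simp: \<psi>_def c\<psi>')
      have m\<psi>: "\<psi> \<in> borel_measurable borel"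
        unfolding \<psi>_def using c\<psi>' by (intro borel_measurable_continuous_on_indicator) auto
      have "bounded (\<psi> ` {p..q})"
        by (intro compact_imp_bounded compact_continuous_image continuous_on_subset[OF c\<psi> sub] compact_Icc)
      then obtain M where M: "M > 0" "\<And>y. y \<in> {p..q} \<Longrightarrow> \<bar>\<psi> y\<bar> \<le> M"
        unfolding bounded_pos by auto
      have M': "\<bar>\<psi> y\<bar> \<le> M" for y
      proof (cases "y \<in> {p..q}")
        case False
        then have "\<psi> y = 0" using supp[of y] by (auto simp: \<psi>_def indicator_def)
        with M(1) show ?thesis by simp
      qed (rule M(2))
      have ic: "isCont \<psi> x0"
        using c\<psi> x0 by (simp add: continuous_on_eq_continuous_at)
      have t0: "(fst \<longlongrightarrow> 0) ?F" and x_lim: "(snd \<longlongrightarrow> x0) ?F"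
        using tendsto_fst[OF tendsto_ident_at] tendsto_snd[OF tendsto_ident_at] by force+
      have pos: "\<forall>\<^sub>F w in ?F. fst w > 0 \<and> snd w > 0"
        by (auto simp: eventually_at_filter intro!: always_eventually)
      let ?ch = "\<lambda>w. cosh (sqrt A * fst w / 2)"
      \<comment> \<open>With this l the series argument (r x y)^2 / 4 of the Bessel factor is l
        y^2.\<close>
      let ?l = "\<lambda>w. (r (fst w))\<^sup>2 * (snd w)\<^sup>2 / 4"
      have ch: "(?ch \<longlongrightarrow> 1) ?F"
        using tendsto_cosh[OF tendsto_divide[OF tendsto_mult[OF tendsto_const t0] tendsto_const], of 2 "sqrt A"] by simp
      have th: "((\<lambda>w. tanh (sqrt A * fst w / 2)) \<longlongrightarrow> 0) ?F"
        using tendsto_tanh[OF tendsto_divide[OF tendsto_mult[OF tendsto_const t0] tendsto_const], of 2 "sqrt A"] by simp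
      have a_top: "filterlim (\<lambda>w. a (fst w)) at_top ?F"
      proof -
        have "filterlim (\<lambda>w. inverse (tanh (sqrt A * fst w / 2))) at_top ?F"
          using pos A by (intro filterlim_inverse_at_top th) (auto elim!: eventually_mono)
        then have "filterlim (\<lambda>w. sqrt A / (8 * \<sigma>) * inverse (tanh (sqrt A * fst w / 2))) at_top ?F"
          using \<sigma> A by (intro filterlim_tendsto_pos_mult_at_top[OF tendsto_const]) auto
        then show ?thesis by (simp add: a_def field_simps)
      qed
      \<comment> \<open>Hence l / a^2 is the square of x / cosh, which tends to x0^2 as t tends to 0
        and x to x0.\<close>
      have ra: "r t / (2 * a t) = 1 / cosh (sqrt A * t / 2)" if "t > 0" for t
        using sh[OF that] that \<sigma> A by (simp add: r_def a_eq field_simps)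
      have l_lim: "((\<lambda>w. ?l w / (a (fst w))\<^sup>2) \<longlongrightarrow> x0\<^sup>2) ?F"
      proof (rule Lim_transform_eventually)
        have "((\<lambda>w. (snd w * (1 / ?ch w))\<^sup>2) \<longlongrightarrow> (x0 * (1 / 1))\<^sup>2) ?F"
          by (intro tendsto_intros x_lim ch) auto
        then show "((\<lambda>w. (snd w * (1 / ?ch w))\<^sup>2) \<longlongrightarrow> x0\<^sup>2) ?F" by simp
        show "\<forall>\<^sub>F w in ?F. (snd w * (1 / ?ch w))\<^sup>2 = ?l w / (a (fst w))\<^sup>2"
          using pos
        proof eventually_elim
          case (elim w)
          show ?case
            unfolding ra[OF conjunct1[OF elim], symmetric] by (simp add: power_mult_distrib power_divide)
        qed
      qed
      \<comment> \<open>What is left of the y-free factor of the kernel once the normalising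
        constant of the weight is split off. The exponents - a x^2 and l / a are singular
        separately, but their sum is the tanh term, so G has an explicit limit.\<close>
      define G where "G w = exp (- (B * fst w / (4 * \<sigma>)) - F (snd w) / (2 * \<sigma>)
          - sqrt A / (8 * \<sigma>) * tanh (sqrt A * fst w / 2) * (snd w)\<^sup>2) / sqrt (snd w) * (snd w / ?ch w) powr (\<beta> + 1)" for w
      have F_lim: "((\<lambda>w. F (snd w)) \<longlongrightarrow> F x0) ?F"
        using isCont_tendsto_compose[OF DERIV_isCont[OF F[OF x0]] x_lim] .
      have "(G \<longlongrightarrow> exp (- (B * 0 / (4 * \<sigma>)) - F x0 / (2 * \<sigma>)
          - sqrt A / (8 * \<sigma>) * 0 * x0\<^sup>2) / sqrt x0 * (x0 / 1) powr (\<beta> + 1)) ?F"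
        unfolding G_def using \<sigma> x0 by (intro tendsto_intros F_lim th ch x_lim t0) auto
      moreover have "((\<lambda>w. 2 * a (fst w) powr (\<beta> + 1) / exp (?l w / a (fst w)) *
            (\<integral>y. \<psi> y * bessel_weight \<beta> (a (fst w)) (?l w) y \<partial>lborel)) \<longlongrightarrow> \<psi> x0) ?F"
        by (rule bessel_weight_concentration[OF \<beta>(1) a_top _ l_lim x0 m\<psi> M' ic]) simp
      ultimately have "((\<lambda>w. G w * (2 * a (fst w) powr (\<beta> + 1) / exp (?l w / a (fst w)) *
            (\<integral>y. \<psi> y * bessel_weight \<beta> (a (fst w)) (?l w) y \<partial>lborel))) \<longlongrightarrow>
          exp (- (B * 0 / (4 * \<sigma>)) - F x0 / (2 * \<sigma>)
          - sqrt A / (8 * \<sigma>) * 0 * x0\<^sup>2) / sqrt x0 * (x0 / 1) powr (\<beta> + 1) * \<psi> x0) ?F"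
        by (rule tendsto_mult)
      also have "exp (- (B * 0 / (4 * \<sigma>)) - F x0 / (2 * \<sigma>)
          - sqrt A / (8 * \<sigma>) * 0 * x0\<^sup>2) / sqrt x0 * (x0 / 1) powr (\<beta> + 1) * \<psi> x0 = \<phi> x0"
      proof -
        have "x0 powr (\<beta> + 1) * x0 powr (- \<beta> - 1/2) = x0 powr (1/2)"
          by (simp flip: powr_add)
        then have "x0 powr (\<beta> + 1) * x0 powr (- \<beta> - 1/2) = sqrt x0"
          using x0 by (simp add: powr_half_sqrt)
        then show ?thesis
          using x0 by (simp add: \<psi>_def exp_diff exp_minus field_simps)
      qed
      finally show ?thesis
      proof (rule Lim_transform_eventually)
        show "\<forall>\<^sub>F w in ?F. G w * (2 * a (fst w) powr (\<beta> + 1) / exp (?l w / a (fst w)) *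
            (\<integral>y. \<psi> y * bessel_weight \<beta> (a (fst w)) (?l w) y \<partial>lborel)) = (case w of (t, x) \<Rightarrow> ?u t x)"
          using pos
        proof eventually_elim
          case (elim w)
          obtain t x where w: "w = (t, x)" by (cases w)
          have tx: "t > 0" "x > 0" using elim by (auto simp: w)
          define l where "l = (r t)\<^sup>2 * x\<^sup>2 / 4"
          define c where "c = r t * exp (- (B * t / (4 * \<sigma>)) - F x / (2 * \<sigma>) - a t * x\<^sup>2) * sqrt x * (r t * x / 2) powr \<beta>"
          have "indicator {0<..} y *\<^sub>R (\<phi> y * P t x y) = c * (\<psi> y * bessel_weight \<beta> (a t) l y)" for y
          proof (cases "y > 0")
            case True
            have e1: "exp (- (B * t / (4 * \<sigma>)) - F x / (2 * \<sigma>) - a t * (x\<^sup>2 + y\<^sup>2)) =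
                exp (- (B * t / (4 * \<sigma>)) - F x / (2 * \<sigma>) - a t * x\<^sup>2) * exp (- (a t * y\<^sup>2))"
              by (simp add: algebra_simps flip: exp_add)
            have "(r t * x * y / 2) powr \<beta> = (r t * x / 2 * y) powr \<beta>" by (simp add: field_simps)
            also have "\<dots> = (r t * x / 2) powr \<beta> * y powr \<beta>"
              by (rule powr_mult)
            finally have e2: "bessel_I \<beta> (r t * x * y) = (r t * x / 2) powr \<beta> * y powr \<beta> * bessel_series \<beta> (l * y\<^sup>2)"
              by (simp add: bessel_I_eq l_def power_mult_distrib)
            have "y powr (- \<beta> - 1/2) * y powr (2 * \<beta> + 1) = y powr (1/2 + \<beta>)"
              by (simp add: algebra_simps flip: powr_add)
            also have "\<dots> = sqrt y * y powr \<beta>"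
              using True by (simp add: powr_add powr_half_sqrt)
            finally have e3: "sqrt y * y powr \<beta> = y powr (- \<beta> - 1/2) * y powr (2 * \<beta> + 1)" ..
            have "\<phi> y * P t x y = \<phi> y * exp (F y / (2 * \<sigma>)) * (sqrt y * y powr \<beta>) * c *
                (exp (- (a t * y\<^sup>2)) * bessel_series \<beta> (l * y\<^sup>2))"
              unfolding P_eq[OF tx(1)] e1 e2 c_def by (simp add: mult_ac)
            then show ?thesis
              unfolding e3 using True by (simp add: \<psi>_def bessel_weight_def mult_ac)
          qed (simp add: \<psi>_def)
          then have u: "?u t x = c * (\<integral>y. \<psi> y * bessel_weight \<beta> (a t) l y \<partial>lborel)"
            by (simp add: set_lebesgue_integral_def)
          have "c = G w * (2 * a t powr (\<beta> + 1) / exp (l / a t))"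
          proof -
            have "x / cosh (sqrt A * t / 2) * a t = r t * x / 2"
              using ra[OF tx(1)] r[OF tx(1)] by (simp add: field_simps)
            then have g1: "(x / cosh (sqrt A * t / 2)) powr (\<beta> + 1) * a t powr (\<beta> + 1) = (r t * x / 2) powr (\<beta> + 1)"
              by (simp only: powr_mult[symmetric])
            have g2: "(r t * x / 2) powr (\<beta> + 1) = (r t * x / 2) powr \<beta> * (r t * x / 2)"
              using r[OF tx(1)] tx by (simp add: powr_add)
            have "l / a t = (r t / (2 * a t)) * (r t / 2) * x\<^sup>2"
              by (simp add: l_def power2_eq_square)
            then have "a t * x\<^sup>2 - l / a t = (a t - r t / (2 * cosh (sqrt A * t / 2))) * x\<^sup>2"
              unfolding ra[OF tx(1)] by (simp add: algebra_simps)
            \<comment> \<open>The singularities at t = 0 cancel here: coth s - 1 / (sinh s cosh s) =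
              tanh s.\<close>
            also have "a t - r t / (2 * cosh (sqrt A * t / 2)) = sqrt A / (8 * \<sigma>) * tanh (sqrt A * t / 2)"
              using sh[OF tx(1)] tx A \<sigma> cosh_square_eq[of "sqrt A * t / 2"]
              by (simp add: a_eq r_def tanh_def field_simps power2_eq_square)
            finally have g3: "- (B * t / (4 * \<sigma>)) - F x / (2 * \<sigma>) - sqrt A / (8 * \<sigma>) * tanh (sqrt A * t / 2) * x\<^sup>2
               = (- (B * t / (4 * \<sigma>)) - F x / (2 * \<sigma>) - a t * x\<^sup>2) + l / a t" by simp
            have "G w * (2 * a t powr (\<beta> + 1) / exp (l / a t)) =
                exp (- (B * t / (4 * \<sigma>)) - F x / (2 * \<sigma>) - a t * x\<^sup>2) / sqrt x * 2 *
                ((x / cosh (sqrt A * t / 2)) powr (\<beta> + 1) * a t powr (\<beta> + 1))"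
              unfolding G_def w fst_conv snd_conv g3 exp_add by simp
            also have "\<dots> = c"
              unfolding g1 g2 c_def using tx real_sqrt_mult_self[of x] by (simp add: field_simps)
            finally show ?thesis ..
          qed
          with u show ?case by (simp add: w l_def mult.assoc)
        qed
      qed
    qed
    show "(\<forall>t>0. \<forall>x>0. set_integrable lborel {0<..} (\<lambda>y. \<phi> y * P t x y)) \<and> solves_pde \<sigma> f \<mu> ?u \<and>
        (\<forall>x0>0. ((\<lambda>(t, x). ?u t x) \<longlongrightarrow> \<phi> x0) (at (0, x0) within {0<..} \<times> {0<..}))"
      using int pde init by blast
  qed
  then show ?thesis
    unfolding P_def by (intro exI)
qed

end
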